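(* Let $\mathcal{L}$ be a simple Euclidean arrangement of $n\ge 3$ pseudolines. Then every pseudoline of $\mathcal{L}$ is adjacent to at least one triangle of $\mathcal{L}$ (i.e., contains an edge of at least one triangle of $\mathcal{L}$).
   Context: A pseudoline in the projective plane $\mathbb{P}$ is a simple noncontractible closed curve; an arrangement of pseudolines in $\mathbb{P}$ is a collection $\{p_0,p_1,\ldots,p_n\}$ of pseudolines that pairwise intersect (necessarily cross) exactly once. Since $\mathbb{P}\setminus p_0$ is homeomorphic to the Euclidean plane $\mathbb{E}$, one regards $\{p_1,\ldots,p_n\}$ as an arrangement of pseudolines in $\mathbb{E}$ (a Euclidean arrangement); any two of its pseudolines cross exactly once in $\mathbb{E}$. An arrangement is simple if no point belongs to more than two pseudolines. The polygons of the arrangement are its bounded (2-dimensional) cells; a triangle is a polygon with exactly three edges. *)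

theory Defs
  imports "HOL-Analysis.Analysis"
begin

section \<open>The real projective plane\<close>

definition proportional :: "real^3 \<Rightarrow> real^3 \<Rightarrow> bool" where
  "proportional x y \<longleftrightarrow> x \<noteq> 0 \<and> y \<noteq> 0 \<and> (\<exists>c. x = c *\<^sub>R y)"

lemma part_equivp_proportional: "part_equivp proportional"
proof (rule part_equivpI)
  have "proportional (axis 1 1) (axis 1 1)"
    unfolding proportional_def by (metis axis_eq_0_iff scaleR_one zero_neq_one)
  then show "\<exists>x. proportional x x" by blast
  show "symp proportional"
  proof (rule sympI)
    fix x y :: "real^3" assume "proportional x y"
    then obtain c where c: "x \<noteq> 0" "y \<noteq> 0" "x = c *\<^sub>R y"
      by (auto simp: proportional_def)
    then have "y = inverse c *\<^sub>R x" by simp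
    with c show "proportional y x" unfolding proportional_def by blast
  qed
  show "transp proportional"
  proof (rule transpI)
    fix x y z :: "real^3" assume "proportional x y" "proportional y z"
    then obtain c d where "x \<noteq> 0" "z \<noteq> 0" "x = c *\<^sub>R y" "y = d *\<^sub>R z"
      by (auto simp: proportional_def)
    moreover from this have "x = (c * d) *\<^sub>R z" by simp
    ultimately show "proportional x z" unfolding proportional_def by blast
  qed
qed

quotient_type proj_plane = "real^3" / partial: proportional
  by (rule part_equivp_proportional)

text \<open>The topology is the quotient topology from \<open>\<real>\<^sup>3 - {0}\<close>. The latter is open in \<open>\<real>\<^sup>3\<close>,
  so openness of the preimage may be tested in \<open>\<real>\<^sup>3\<close>.\<close>

instantiation proj_plane :: topological_space
begin

definition open_proj_plane :: "proj_plane set \<Rightarrow> bool" where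
  "open_proj_plane U \<longleftrightarrow> open {x. x \<noteq> 0 \<and> abs_proj_plane x \<in> U}"

instance
proof
  show "open (UNIV :: proj_plane set)"
    by (simp add: open_proj_plane_def open_Collect_neq)
next
  fix S T :: "proj_plane set" assume "open S" "open T"
  then have "open ({x. x \<noteq> 0 \<and> abs_proj_plane x \<in> S} \<inter> {x. x \<noteq> 0 \<and> abs_proj_plane x \<in> T})"
    unfolding open_proj_plane_def by (rule open_Int)
  moreover have "{x. x \<noteq> 0 \<and> abs_proj_plane x \<in> S} \<inter> {x. x \<noteq> 0 \<and> abs_proj_plane x \<in> T}
      = {x. x \<noteq> 0 \<and> abs_proj_plane x \<in> S \<inter> T}" by auto
  ultimately show "open (S \<inter> T)" by (simp add: open_proj_plane_def)
next
  fix K :: "proj_plane set set" assume "\<forall>S\<in>K. open S"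
  then have "open (\<Union>S\<in>K. {x. x \<noteq> 0 \<and> abs_proj_plane x \<in> S})"
    unfolding open_proj_plane_def by (intro open_UN) auto
  moreover have "(\<Union>S\<in>K. {x. x \<noteq> 0 \<and> abs_proj_plane x \<in> S})
      = {x. x \<noteq> 0 \<and> abs_proj_plane x \<in> \<Union>K}" by auto
  ultimately show "open (\<Union>K)" by (simp add: open_proj_plane_def)
qed

end


section \<open>Pseudolines and arrangements\<close>

definition pseudoline :: "proj_plane set \<Rightarrow> bool" where
  "pseudoline p \<longleftrightarrow>
     (\<exists>g. simple_path g \<and> pathfinish g = pathstart g \<and> path_image g = p \<and>
          \<not> (\<exists>a. homotopic_loops UNIV g (\<lambda>_. a)))"

definition projective_arrangement :: "proj_plane set set \<Rightarrow> bool" where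
  "projective_arrangement P \<longleftrightarrow>
     finite P \<and> (\<forall>p\<in>P. pseudoline p) \<and> pairwise (\<lambda>p q. \<exists>!x. x \<in> p \<inter> q) P"

text \<open>The type \<open>complex\<close> serves as the Euclidean plane, since the Jordan curve theorem is
  stated for it. An arrangement \<open>P\<close> in the projective plane becomes Euclidean by sending a
  member \<open>p0\<close> to infinity. The last conjunct says that no two of the remaining pseudolines
  meet on \<open>p0\<close>, that is, that there are no parallels in the Euclidean plane. That two
  pseudolines cross at their common point is not assumed: it follows from their being
  noncontractible.\<close>

definition Euclidean_arrangement :: "complex set set \<Rightarrow> bool" where
  "Euclidean_arrangement L \<longleftrightarrow>
     (\<exists>P p0 h h'. projective_arrangement P \<and> p0 \<in> P \<and> homeomorphism (- p0) UNIV h h' \<and>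
        L = (\<lambda>p. h ` (p - p0)) ` (P - {p0})) \<and>
     pairwise (\<lambda>l m. \<exists>!x. x \<in> l \<inter> m) L"

definition simple_arrangement :: "complex set set \<Rightarrow> bool" where
  "simple_arrangement L \<longleftrightarrow> (\<forall>x. card {l \<in> L. x \<in> l} \<le> 2)"


section \<open>Cells\<close>

text \<open>Edges are taken without their end points.\<close>

definition edges :: "complex set set \<Rightarrow> complex set set" where
  "edges L = (\<Union>l\<in>L. components (l - \<Union>(L - {l})))"

definition polygons :: "complex set set \<Rightarrow> complex set set" where
  "polygons L = {c \<in> components (- \<Union>L). bounded c}"

definition edges_of :: "complex set set \<Rightarrow> complex set \<Rightarrow> complex set set" where
  "edges_of L c = {e \<in> edges L. e \<subseteq> frontier c}"

definition triangles :: "complex set set \<Rightarrow> complex set set" where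
  "triangles L = {c \<in> polygons L. card (edges_of L c) = 3}"

end

theory Submission
  imports Defs
begin

text \<open>
  Two facts suffice. First, two pseudolines cross at their common point, in the sense that the
  two rays of one of them lie in different components of the complement of the other. To see
  this, lift to the sphere: a noncontractible loop lifts to a path from a point to its antipode,
  and such a path meets every compact connected symmetric set. The last claim holds because,
  after stereographic projection from the start of the path, the set would otherwise admit a
  continuous logarithm \<open>L\<close>, and \<open>L (- x) - L x\<close> would be a constant odd multiple of
  \<open>\<i> * pi\<close>, which changing the sign of \<open>x\<close> contradicts. Second, crossing yields Pasch's axiom, and
  a minimality argument along a given pseudoline then produces three pseudolines whose mutual
  segments contain no further crossing. The interior of the Jordan curve that they form is the
  required triangle.
\<close>

section \<open>Antipodally symmetric sets in the sphere\<close>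

text \<open>The pseudolines are merely continuous, so no local notion of transversality is at hand;
  crossing has to come from the global fact that they are noncontractible. Stereographic projection
  puts the start of the path at infinity and its antipode at 0. A path that avoids the symmetric set
  therefore places 0 in the unbounded component of the complement of the projected set, and this is
  what supplies the logarithm. In the plane, crossing is used only as separation by the complement
  of a line. The number of components does not matter: Pasch's axiom just needs that lying in the
  same component is an equivalence relation. The Jordan curve theorem enters for the closed curve
  made of three segments. That no line enters its interior is a separate point, which rests on the
  unboundedness of both rays of a line.\<close>

lemma no_odd_logarithm:
  fixes L :: "'a::real_normed_vector \<Rightarrow> complex"
  assumes "connected K" "K \<noteq> {}" and sym: "\<And>x. x \<in> K \<Longrightarrow> - x \<in> K"
    and L: "continuous_on K L" and odd: "\<And>x. x \<in> K \<Longrightarrow> exp (L (- x)) = - exp (L x)"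
  shows False
proof -
  define D where "D x = L (- x) - L x" for x
  have expD: "exp (D x) = -1" if "x \<in> K" for x
    by (simp add: D_def exp_diff odd that)
  have "continuous_on K (\<lambda>x. L (- x))"
    by (rule continuous_on_compose2[OF L]) (auto intro: continuous_intros sym)
  then have "continuous_on K D"
    unfolding D_def using L by (intro continuous_intros)
  \<comment> \<open>All values of \<open>D\<close> are logarithms of -1, so distinct ones are at
    least \<open>2 * pi\<close> apart; a continuous function with such a range is constant on a
    connected set.\<close>
  moreover have "\<exists>e>0. \<forall>y. y \<in> K \<and> D y \<noteq> D x \<longrightarrow> e \<le> cmod (D y - D x)" if "x \<in> K" for x
  proof (intro exI[of _ "2*pi"] conjI allI impI)
    fix y assume y: "y \<in> K \<and> D y \<noteq> D x"
    then have "exp (D y) = exp (D x)" using expD that by simp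
    then obtain n :: int where n: "D y = D x + of_int (2 * n) * of_real pi * \<i>"
      unfolding exp_eq by auto
    with y have "n \<noteq> 0" by auto
    then have "1 \<le> \<bar>real_of_int n\<bar>" by linarith
    then have "2 * pi * 1 \<le> 2 * pi * \<bar>real_of_int n\<bar>"
      by (intro mult_left_mono) auto
    also have "\<dots> = cmod (D y - D x)" by (simp add: n norm_mult)
    finally show "2 * pi \<le> cmod (D y - D x)" by simp
  qed auto
  ultimately have "D constant_on K"
    by (intro continuous_discrete_range_constant[OF \<open>connected K\<close>])
  moreover obtain x where x: "x \<in> K" using \<open>K \<noteq> {}\<close> by blast
  \<comment> \<open>By its definition \<open>D (- x) = - D x\<close>, so constancy forces
    \<open>D x = 0\<close>, which is no logarithm of -1.\<close>
  ultimately have "D (- x) = D x" using sym unfolding constant_on_def by metis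
  then have "D x = 0" by (simp add: D_def)
  with expD[OF x] show False by simp
qed

text \<open>Stereographic projection from the pole \<open>axis 3 1\<close> onto the equatorial
  plane. Division by zero sends the pole itself to 0, hence the recurring exclusion of that
  point.\<close>

definition stereo :: "real^3 \<Rightarrow> complex" where
  "stereo x = Complex (x$1) (x$2) / of_real (1 - x$3)"

lemma sphere_vec3: "x \<in> sphere 0 1 \<longleftrightarrow> (x$1)\<^sup>2 + (x$2)\<^sup>2 + (x$3)\<^sup>2 = 1" for x :: "real^3"
  by (simp add: norm_vec_def L2_set_def sum_3)

lemma sphere_third_less_1:
  fixes x :: "real^3"
  assumes "x \<in> sphere 0 1" "x \<noteq> axis 3 1"
  shows "x$3 < 1"
proof -
  have s: "(x$1)\<^sup>2 + (x$2)\<^sup>2 + (x$3)\<^sup>2 = 1" using assms sphere_vec3 by blast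
  then have "(x$3)\<^sup>2 \<le> 1\<^sup>2" by (smt (verit) one_power2 zero_le_power2)
  then have "x$3 \<le> 1" by (rule power2_le_imp_le) simp
  moreover have "x$3 \<noteq> 1"
  proof
    assume "x$3 = 1"
    with s have "x$1 = 0" "x$2 = 0" by (auto simp: sum_power2_eq_zero_iff)
    with \<open>x$3 = 1\<close> have "x = axis 3 1" by (simp add: vec_eq_iff forall_3 axis_def)
    with assms show False by simp
  qed
  ultimately show ?thesis by simp
qed

text \<open>The modulus is a strictly increasing function of the height. This recovers the third
  coordinate for injectivity, shows that only the antipode of the pole goes to 0, and bounds the
  height away from 1 wherever the projection is bounded.\<close>

lemma norm_stereo:
  assumes "x \<in> sphere 0 1" "x \<noteq> axis 3 1"
  shows "(cmod (stereo x))\<^sup>2 = (1 + x$3) / (1 - x$3)"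
proof -
  have lt: "x$3 < 1" by (rule sphere_third_less_1[OF assms])
  have "(x$1)\<^sup>2 + (x$2)\<^sup>2 = (1 - x$3) * (1 + x$3)"
    using assms sphere_vec3 by (simp add: algebra_simps power2_eq_square)
  then have "(cmod (stereo x))\<^sup>2 = (1 - x$3) * (1 + x$3) / (1 - x$3)\<^sup>2"
    unfolding stereo_def norm_divide power_divide cmod_power2
    by (simp add: norm_of_real del: of_real_diff)
  then show ?thesis using lt by (simp add: power2_eq_square)
qed

lemma inj_on_stereo: "inj_on stereo (sphere 0 1 - {axis 3 1})"
proof (rule inj_onI)
  fix x y assume x: "x \<in> sphere 0 1 - {axis 3 1}" and y: "y \<in> sphere 0 1 - {axis 3 1}"
    and eq: "stereo x = stereo y"
  have lt: "x$3 < 1" "y$3 < 1" using x y sphere_third_less_1 by auto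
  have "(1 + x$3) / (1 - x$3) = (1 + y$3) / (1 - y$3)"
    using norm_stereo x y eq by (metis Diff_iff insertI1)
  then have x3: "x$3 = y$3" using lt by (simp add: divide_simps) (simp add: algebra_simps)
  then have "x$1 = y$1" "x$2 = y$2" using eq lt by (auto simp: stereo_def complex_eq_iff)
  with x3 show "x = y" by (simp add: vec_eq_iff forall_3)
qed

lemma continuous_on_stereo: "continuous_on (sphere 0 1 - {axis 3 1}) stereo"
proof -
  have "continuous_on (sphere 0 1 - {axis 3 1 :: real^3})
     (\<lambda>x. (of_real (x$1) + \<i> * of_real (x$2)) / of_real (1 - x$3) :: complex)"
    using sphere_third_less_1 by (intro continuous_intros) fastforce
  then show ?thesis unfolding stereo_def[abs_def] Complex_eq .
qed

text \<open>In the plane the antipodal map is \<open>z\<close> to \<open>- 1 / cnj z\<close>. It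
  inverts the modulus, so only the direction of \<open>z\<close> is odd; this is why the logarithm
  is taken of \<open>sgn z\<close> and not of \<open>z\<close>.\<close>

lemma stereo_minus:
  assumes "x \<in> sphere 0 1" "x \<noteq> axis 3 1" "- x \<noteq> axis 3 1"
  shows "sgn (stereo (- x)) = - sgn (stereo x)"
proof -
  have "x$3 < 1" "(- x)$3 < 1" using assms sphere_third_less_1[of x] sphere_third_less_1[of "- x"] by auto
  then have r: "(1 - x$3) / (1 + x$3) > 0" and ne: "1 - x$3 \<noteq> 0" "1 + x$3 \<noteq> 0" by auto
  have ne': "complex_of_real (1 - x$3) \<noteq> 0" "complex_of_real (1 + x$3) \<noteq> 0"
    unfolding of_real_eq_0_iff by (fact ne)+
  have "Complex (- (x$1)) (- (x$2)) = - Complex (x$1) (x$2)" by (simp add: complex_eq_iff)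
  then have "stereo (- x) = of_real (- ((1 - x$3) / (1 + x$3))) * stereo x"
    using ne' unfolding stereo_def by simp
  then have "sgn (stereo (- x)) = sgn (of_real (- ((1 - x$3) / (1 + x$3)))) * sgn (stereo x)"
    by (simp only: sgn_mult)
  also have "sgn (complex_of_real (- ((1 - x$3) / (1 + x$3)))) = - 1"
    using r by (metis neg_less_0_iff_less of_real_1 of_real_minus sgn_minus sgn_of_real sgn_pos)
  finally show ?thesis by simp
qed

text \<open>The normalised case: the path starts at the pole of projection and never returns to it,
  so the rest of it projects to a connected set that runs from infinity to 0.\<close>

lemma symmetric_connected_meets_path_aux:
  fixes c :: "real \<Rightarrow> real^3"
  assumes c: "path c" "path_image c \<subseteq> sphere 0 1" "c 0 = axis 3 1" "c 1 = - axis 3 1"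
    "\<And>t. t \<in> {0<..1} \<Longrightarrow> c t \<noteq> axis 3 1"
    and K: "compact K" "connected K" "K \<noteq> {}" "K \<subseteq> sphere 0 1" and sym: "\<And>x. x \<in> K \<Longrightarrow> - x \<in> K"
  shows "K \<inter> path_image c \<noteq> {}"
proof
  assume disj: "K \<inter> path_image c = {}"
  have "axis 3 1 \<in> path_image c" "- axis 3 1 \<in> path_image c"
    using c(3,4) unfolding path_image_def by (metis atLeastAtMost_iff image_eqI order.refl zero_le_one)+
  then have nin: "axis 3 1 \<notin> K" "- axis 3 1 \<notin> K" using disj by auto
  then have Ksub: "K \<subseteq> sphere 0 1 - {axis 3 1}" using K by auto
  have nin0: "stereo x \<noteq> 0" if "x \<in> K" for x
  proof -
    have "- x \<noteq> axis 3 1" using that nin by (metis sym)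
    moreover have "- x \<in> sphere 0 1" using K sym that by blast
    ultimately have "(- x)$3 < 1" by (rule sphere_third_less_1[rotated])
    moreover have "x$3 < 1" using that Ksub by (intro sphere_third_less_1) auto
    ultimately have "(cmod (stereo x))\<^sup>2 > 0" using norm_stereo[of x] that Ksub by force
    then show ?thesis by auto
  qed
  define S where "S = stereo ` K"
  have contK: "continuous_on K stereo" using continuous_on_stereo continuous_on_subset Ksub by blast
  have "compact S" unfolding S_def using contK K by (intro compact_continuous_image)
  have "0 \<notin> S" using nin0 by (auto simp: S_def)
  \<comment> \<open>The start is dropped because it goes to infinity. What remains contains 0,
    avoids \<open>S\<close>, and is shown to be unbounded.\<close>
  let ?R = "stereo ` c ` {0<..1}"
  have csub: "c ` {0<..1} \<subseteq> sphere 0 1 - {axis 3 1}"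
    using c(2,5) by (auto simp: path_image_def image_subset_iff)
  have "continuous_on {0<..1} c" using c(1) unfolding path_def
    by (rule continuous_on_subset) auto
  then have conn: "connected ?R"
    by (intro connected_continuous_image continuous_on_subset[OF continuous_on_stereo csub]) auto
  have "?R \<inter> S = {}"
  proof -
    have False if "t \<in> {0<..1}" "x \<in> K" "stereo (c t) = stereo x" for t x
    proof -
      have "c t \<in> sphere 0 1 - {axis 3 1}" "x \<in> sphere 0 1 - {axis 3 1}"
        using that(1,2) csub Ksub by blast+
      then have "c t = x" using that(3) by (intro inj_onD[OF inj_on_stereo])
      with that disj show False by (auto simp: path_image_def)
    qed
    then show ?thesis unfolding S_def by (blast dest: sym)
  qed
  moreover have "0 \<in> ?R"
  proof -
    have "stereo (c 1) = 0" using c(4) by (simp add: stereo_def axis_def complex_eq_iff)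
    then show ?thesis by (metis greaterThanAtMost_iff image_eqI less_numeral_extra(1) order.refl)
  qed
  ultimately have sub: "?R \<subseteq> connected_component_set (- S) 0"
    by (intro connected_component_maximal conn) auto
  have "\<not> bounded ?R"
  proof
    assume "bounded ?R"
    then obtain B where B: "\<And>t. t \<in> {0<..1} \<Longrightarrow> cmod (stereo (c t)) \<le> B"
      unfolding bounded_iff by (metis imageI)
    have bd: "1 + c t $ 3 \<le> B\<^sup>2 * (1 - c t $ 3)" if "t \<in> {0<..1}" for t
    proof -
      have ct: "c t \<in> sphere 0 1" "c t \<noteq> axis 3 1" using csub that by blast+
      have "(cmod (stereo (c t)))\<^sup>2 \<le> B\<^sup>2" using B[OF that] by (intro power_mono) auto
      then show ?thesis using norm_stereo[OF ct] sphere_third_less_1[OF ct]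
        by (simp add: divide_simps)
    qed
    have cc: "continuous_on {0..1} (\<lambda>t. 1 + c t $ 3 - B\<^sup>2 * (1 - c t $ 3))"
      using c(1) unfolding path_def by (intro continuous_intros)
    \<comment> \<open>The bound passes to the limit at the start of the path, where the height is 1
      and it would read 2 <= 0.\<close>
    have "1 + c 0 $ 3 - B\<^sup>2 * (1 - c 0 $ 3) \<le> 0"
    proof (rule continuous_le_on_closure[where S = "{0<..1}" and f = "\<lambda>t. 1 + c t $ 3 - B\<^sup>2 * (1 - c t $ 3)"])
      show "continuous_on (closure {0<..1}) (\<lambda>t. 1 + c t $ 3 - B\<^sup>2 * (1 - c t $ 3))" using cc by simp
      show "1 + c t $ 3 - B\<^sup>2 * (1 - c t $ 3) \<le> 0" if "t \<in> {0<..1}" for t using bd[OF that] by simp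
    qed simp
    then show False using c(3) by simp
  qed
  \<comment> \<open>Borsuk's criterion: if 0 is in an unbounded component of the complement of the
    compact set \<open>S\<close>, then \<open>z / |z|\<close> is null-homotopic on \<open>S\<close>,
    hence has a continuous logarithm.\<close>
  then have "\<not> bounded (connected_component_set (- S) 0)" using sub bounded_subset by blast
  then obtain d where d: "homotopic_with_canon (\<lambda>x. True) S (sphere 0 1)
        (\<lambda>x. inverse (norm (x - 0)) *\<^sub>R (x - 0)) (\<lambda>x. d)"
    using Borsuk_map_essential_bounded_component[OF \<open>compact S\<close> \<open>0 \<notin> S\<close>] by blast
  then have "homotopic_with_canon (\<lambda>x. True) S (- {0}) (\<lambda>x. inverse (norm (x - 0)) *\<^sub>R (x - 0)) (\<lambda>x. d)"
    by (rule homotopic_with_subset_right) auto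
  then obtain L where L: "continuous_on S L" "\<And>z. z \<in> S \<Longrightarrow> sgn z = exp (L z)"
    using inessential_eq_continuous_logarithm[of S "\<lambda>x. inverse (norm (x - 0)) *\<^sub>R (x - 0)"]
    by (auto simp: sgn_div_norm)
  show False
  proof (rule no_odd_logarithm[OF K(2,3) sym, of "L \<circ> stereo"])
    show "continuous_on K (L \<circ> stereo)"
      using contK L(1) unfolding S_def by (intro continuous_on_compose)
    fix x assume x: "x \<in> K"
    have "exp (L (stereo (- x))) = sgn (stereo (- x))" using L(2) sym x by (simp add: S_def)
    also have "\<dots> = - sgn (stereo x)" using x Ksub nin sym[OF x] by (intro stereo_minus) auto
    also have "\<dots> = - exp (L (stereo x))" using L(2) x by (simp add: S_def)
    finally show "exp ((L \<circ> stereo) (- x)) = - exp ((L \<circ> stereo) x)" by simp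
  qed
qed

text \<open>An orthogonal map moves the start to the pole and commutes with the antipodal map.
  Injectivity of the arc guarantees that the start is not revisited.\<close>

lemma symmetric_connected_meets_path:
  fixes c :: "real \<Rightarrow> real^3"
  assumes c: "arc c" "path_image c \<subseteq> sphere 0 1" "pathfinish c = - pathstart c"
    and K: "compact K" "connected K" "K \<noteq> {}" "K \<subseteq> sphere 0 1" and sym: "\<And>x. x \<in> K \<Longrightarrow> - x \<in> K"
  shows "K \<inter> path_image c \<noteq> {}"
proof -
  have "norm (pathstart c) = norm (axis 3 1 :: real^3)" using c(2) by auto
  then obtain f :: "real^3 \<Rightarrow> real^3" where f: "orthogonal_transformation f" "f (pathstart c) = axis 3 1"
    using orthogonal_transformation_exists by blast
  have lin: "linear f" using f(1) orthogonal_transformation by blast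
  have nf: "norm (f x) = norm x" for x using f(1) orthogonal_transformation by blast
  have injf: "inj f" using f(1) orthogonal_transformation_inj by blast
  have cf: "continuous_on X f" for X using lin linear_continuous_on linear_conv_bounded_linear by blast
  have "f ` K \<inter> path_image (f \<circ> c) \<noteq> {}"
  proof (rule symmetric_connected_meets_path_aux)
    show "path (f \<circ> c)" using c(1) cf by (auto intro: path_continuous_image arc_imp_path)
    show "path_image (f \<circ> c) \<subseteq> sphere 0 1" using c(2) by (auto simp: path_image_compose nf)
    show "(f \<circ> c) 0 = axis 3 1" using f(2) by (simp add: pathstart_def)
    show "(f \<circ> c) 1 = - axis 3 1" using f(2) c(3) lin by (simp add: pathstart_def pathfinish_def linear_neg)
    show "(f \<circ> c) t \<noteq> axis 3 1" if "t \<in> {0<..1}" for t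
    proof
      assume "(f \<circ> c) t = axis 3 1"
      then have "c t = c 0" using f(2) injD[OF injf] by (simp add: pathstart_def)
      then have "t = 0" using c(1) that by (auto simp: arc_def dest: inj_onD)
      with that show False by simp
    qed
    show "compact (f ` K)" "connected (f ` K)" using K cf
      by (auto intro: compact_continuous_image connected_continuous_image)
    show "f ` K \<noteq> {}" "f ` K \<subseteq> sphere 0 1" using K by (auto simp: nf)
    show "- x \<in> f ` K" if "x \<in> f ` K" for x
      using that sym by (auto simp: linear_neg[OF lin, symmetric])
  qed
  then show ?thesis
    unfolding path_image_compose image_Int[OF injf, symmetric] by blast
qed


section \<open>The double cover of the projective plane\<close>

lemma abs_proj_plane_eq_iff:
  assumes "x \<noteq> 0" "y \<noteq> 0"
  shows "abs_proj_plane x = abs_proj_plane y \<longleftrightarrow> (\<exists>c. x = c *\<^sub>R y)"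
proof -
  have refl: "proportional z z" if "z \<noteq> 0" for z
    using that unfolding proportional_def by (metis scaleR_one)
  show ?thesis
    using Quotient3_rel[OF Quotient3_proj_plane, of x y] refl[OF assms(1)] refl[OF assms(2)] assms
    by (auto simp: proportional_def)
qed

lemma abs_proj_plane_scaleR:
  assumes "x \<noteq> 0" "c \<noteq> 0"
  shows "abs_proj_plane (c *\<^sub>R x) = abs_proj_plane x"
  using assms by (subst abs_proj_plane_eq_iff) auto

lemma proj_plane_eq_abs_sphere:
  obtains x where "x \<in> sphere 0 1" "abs_proj_plane x = P"
proof -
  define r where "r = rep_proj_plane P"
  have "proportional r r" and P: "abs_proj_plane r = P"
    using Quotient3_rep_reflp[OF Quotient3_proj_plane] Quotient3_abs_rep[OF Quotient3_proj_plane]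
    by (auto simp: r_def)
  then have "r \<noteq> 0" by (simp add: proportional_def)
  then have "abs_proj_plane (sgn r) = P" "sgn r \<in> sphere 0 1"
    using P abs_proj_plane_scaleR[of r "inverse (norm r)"] by (auto simp: sgn_div_norm norm_sgn)
  then show ?thesis using that by blast
qed

lemma abs_proj_plane_sphere_eq_iff:
  assumes "x \<in> sphere 0 1" "y \<in> sphere 0 1"
  shows "abs_proj_plane x = abs_proj_plane y \<longleftrightarrow> x = y \<or> x = - y"
proof
  assume "abs_proj_plane x = abs_proj_plane y"
  then obtain c where c: "x = c *\<^sub>R y"
    using assms abs_proj_plane_eq_iff[of x y] by fastforce
  then have "\<bar>c\<bar> = 1" using assms by auto
  then have "c = 1 \<or> c = -1" by linarith
  with c show "x = y \<or> x = - y" by auto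
next
  have "y \<noteq> 0" using assms by auto
  then have "abs_proj_plane (- y) = abs_proj_plane y"
    using abs_proj_plane_scaleR[of y "-1"] by simp
  then show "x = y \<or> x = - y \<Longrightarrow> abs_proj_plane x = abs_proj_plane y" by auto
qed

lemma abs_proj_plane_minus: "x \<in> sphere 0 1 \<Longrightarrow> abs_proj_plane (- x) = abs_proj_plane x"
  by (subst abs_proj_plane_sphere_eq_iff) auto

lemma continuous_on_abs_proj_plane: "continuous_on (- {0}) abs_proj_plane"
proof -
  have "abs_proj_plane -` B \<inter> - {0} = {x. x \<noteq> 0 \<and> abs_proj_plane x \<in> B}" for B by auto
  then show ?thesis
    by (subst continuous_on_open_vimage) (auto simp: open_proj_plane_def)
qed

lemma continuous_on_abs_proj_plane_sphere: "continuous_on (sphere 0 1) abs_proj_plane"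
  by (rule continuous_on_subset[OF continuous_on_abs_proj_plane]) auto

text \<open>This depends only on the line spanned by \<open>x\<close>, so it embeds the projective plane into a
  Euclidean space. The lifting theorems for covering spaces are stated for normed spaces only.\<close>

definition line_projection :: "real^3 \<Rightarrow> real^3^3" where
  "line_projection x = (\<chi> i. (x$i / (x \<bullet> x)) *\<^sub>R x)"

text \<open>The matrix is the orthogonal projection onto the line spanned by \<open>x\<close>. Its
  value at a vector not orthogonal to \<open>x\<close> spans that line, which yields both
  injectivity and the local inverses of the covering.\<close>

lemma line_projection_mult: "line_projection x *v a = ((x \<bullet> a) / (x \<bullet> x)) *\<^sub>R x"
  by (simp add: line_projection_def vec_eq_iff matrix_vector_mult_def inner_vec_def[of x a]
      sum_distrib_left sum_distrib_right sum_divide_distrib mult_ac)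

lemma line_projection_scaleR: "c \<noteq> 0 \<Longrightarrow> line_projection (c *\<^sub>R x) = line_projection x"
  by (simp add: line_projection_def vec_eq_iff)

lemma continuous_on_line_projection: "continuous_on (- {0}) line_projection"
  unfolding line_projection_def by (intro continuous_intros) auto

definition proj_embed :: "proj_plane \<Rightarrow> real^3^3" where
  "proj_embed P = line_projection (rep_proj_plane P)"

lemma proj_embed_abs:
  assumes "x \<noteq> 0"
  shows "proj_embed (abs_proj_plane x) = line_projection x"
proof -
  have "proportional x x" using assms unfolding proportional_def by (metis scaleR_one)
  then have "proportional (rep_proj_plane (abs_proj_plane x)) x"
    by (rule rep_abs_rsp_left[OF Quotient3_proj_plane])
  then show ?thesis unfolding proj_embed_def proportional_def by (metis line_projection_scaleR scaleR_zero_left)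
qed

lemma inj_proj_embed: "inj proj_embed"
proof (rule injI)
  fix P Q assume eq: "proj_embed P = proj_embed Q"
  obtain x where x: "x \<in> sphere 0 1" "abs_proj_plane x = P" by (rule proj_plane_eq_abs_sphere)
  obtain y where y: "y \<in> sphere 0 1" "abs_proj_plane y = Q" by (rule proj_plane_eq_abs_sphere)
  have ne: "x \<noteq> 0" "y \<noteq> 0" using x y by auto
  have "line_projection x = line_projection y" using eq x y proj_embed_abs ne by auto
  \<comment> \<open>Projection onto the line of \<open>x\<close> fixes \<open>x\<close>, while
    projection onto the line of \<open>y\<close> lands on the line of \<open>y\<close>.\<close>
  then have "((x \<bullet> x) / (x \<bullet> x)) *\<^sub>R x = ((y \<bullet> x) / (y \<bullet> y)) *\<^sub>R y"
    by (metis line_projection_mult)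
  then have "x = ((y \<bullet> x) / (y \<bullet> y)) *\<^sub>R y" using ne by simp
  then show "P = Q" using x y ne abs_proj_plane_eq_iff by blast
qed

text \<open>The representatives chosen by \<open>rep_proj_plane\<close> need not vary continuously.
  The quotient topology lets the preimage be tested upstairs, where the map is the explicit
  \<open>line_projection\<close>.\<close>

lemma continuous_on_proj_embed: "continuous_on UNIV proj_embed"
  unfolding continuous_on_open_vimage[OF open_UNIV]
proof (intro allI impI)
  fix B :: "(real^3^3) set" assume "open B"
  have "{x. x \<noteq> 0 \<and> abs_proj_plane x \<in> proj_embed -` B \<inter> UNIV} = line_projection -` B \<inter> - {0}"
    by (auto simp: proj_embed_abs)
  moreover have "open (line_projection -` B \<inter> - {0})"
    using continuous_on_line_projection \<open>open B\<close> by (subst (asm) continuous_on_open_vimage) auto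
  ultimately show "open (proj_embed -` B \<inter> UNIV)" by (simp add: open_proj_plane_def)
qed

text \<open>The lines not orthogonal to \<open>a\<close> form an evenly covered neighbourhood of the
  line of \<open>a\<close>. Over it lie the two open hemispheres on which
  \<open>x \<bullet> a\<close> is positive or negative, and the sheets are inverted by normalising
  \<open>M *v a\<close> with the matching sign.\<close>

lemma covering_space_line_projection:
  "covering_space (sphere 0 1) line_projection (line_projection ` sphere 0 1)"
proof
  let ?S = "sphere 0 1 :: (real^3) set" and ?V = "line_projection ` sphere 0 1"
  show cont: "continuous_on ?S line_projection"
    by (rule continuous_on_subset[OF continuous_on_line_projection]) auto
  show "line_projection ` ?S = ?V" by simp
  fix A assume "A \<in> ?V"
  then obtain a where a: "a \<in> ?S" "A = line_projection a" by auto
  define T where "T = ?V \<inter> {M. M *v a \<noteq> 0}"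
  define H where "H \<sigma> = {x \<in> ?S. 0 < \<sigma> * (x \<bullet> a)}" for \<sigma> :: real
  have mult: "line_projection x *v a = (x \<bullet> a) *\<^sub>R x" if "x \<in> ?S" for x
    using that by (simp add: line_projection_mult dot_square_norm)
  have cont_mult: "continuous_on X (\<lambda>M :: real^3^3. M *v a)" for X
    unfolding matrix_vector_mult_def by (intro continuous_intros)
  then have "open {M :: real^3^3. M *v a \<noteq> 0}"
    by (intro open_Collect_neq continuous_on_const)
  then have openT: "openin (top_of_set ?V) T" unfolding T_def by (rule openin_open_Int)
  have AT: "A \<in> T" using a mult[OF a(1)] by (auto simp: T_def dot_square_norm)
  have openH: "openin (top_of_set ?S) (H \<sigma>)" for \<sigma>
  proof -
    have "open {x. 0 < \<sigma> * (x \<bullet> a)}" by (intro open_Collect_less continuous_intros)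
    moreover have "H \<sigma> = ?S \<inter> {x. 0 < \<sigma> * (x \<bullet> a)}" by (auto simp: H_def)
    ultimately show ?thesis by (simp add: openin_open_Int)
  qed
  have homeo: "homeomorphism (H \<sigma>) T line_projection (\<lambda>M. \<sigma> *\<^sub>R sgn (M *v a))" if "\<sigma> \<in> {1, -1}" for \<sigma>
  proof
    show "continuous_on (H \<sigma>) line_projection"
      by (rule continuous_on_subset[OF cont]) (auto simp: H_def)
    show "continuous_on T (\<lambda>M. \<sigma> *\<^sub>R sgn (M *v a))"
      unfolding sgn_div_norm by (intro continuous_intros cont_mult) (auto simp: T_def)
    have inv: "\<sigma> *\<^sub>R sgn (line_projection x *v a) = x" if x: "x \<in> H \<sigma>" for x
    proof -
      have "x \<in> ?S" "0 < \<sigma> * (x \<bullet> a)" using x by (auto simp: H_def)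
      then show ?thesis using \<open>\<sigma> \<in> {1, -1}\<close>
        by (auto simp: mult sgn_div_norm)
    qed
    then show "\<And>x. x \<in> H \<sigma> \<Longrightarrow> \<sigma> *\<^sub>R sgn (line_projection x *v a) = x" .
    show "line_projection ` H \<sigma> \<subseteq> T"
      by (auto simp: T_def H_def mult)
    have surj: "\<exists>x\<in>H \<sigma>. M = line_projection x" if M: "M \<in> T" for M
    proof -
      obtain x where x: "x \<in> ?S" "M = line_projection x" "x \<bullet> a \<noteq> 0"
        using M by (auto simp: T_def mult)
      have neg: "line_projection (- x) = M" using line_projection_scaleR[of "-1" x] x by simp
      have "0 < \<sigma> * (x \<bullet> a) \<or> 0 < \<sigma> * (- x \<bullet> a)"
        using x(3) \<open>\<sigma> \<in> {1, -1}\<close> by auto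
      then have "x \<in> H \<sigma> \<or> - x \<in> H \<sigma>" using x(1) by (simp add: H_def)
      then show ?thesis using x(2) neg by metis
    qed
    then show "(\<lambda>M. \<sigma> *\<^sub>R sgn (M *v a)) ` T \<subseteq> H \<sigma>" using inv by fastforce
    show "line_projection (\<sigma> *\<^sub>R sgn (M *v a)) = M" if "M \<in> T" for M
      using surj[OF that] inv by auto
  qed
  have T_iff: "line_projection x \<in> T \<longleftrightarrow> x \<bullet> a \<noteq> 0" if "x \<in> ?S" for x
  proof -
    have "x \<noteq> 0" using that by auto
    then show ?thesis unfolding T_def using that mult[OF that] by simp
  qed
  have "\<Union> {H 1, H (- 1)} = ?S \<inter> line_projection -` T"
    using T_iff by (auto simp: H_def)
  moreover have "pairwise disjnt {H 1, H (- 1)}"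
    by (auto simp: pairwise_def disjnt_def H_def)
  moreover have "\<forall>u\<in>{H 1, H (- 1)}. \<exists>q. homeomorphism u T line_projection q"
    using homeo by blast
  ultimately show "\<exists>T. A \<in> T \<and> openin (top_of_set ?V) T \<and>
      (\<exists>v. \<Union> v = ?S \<inter> line_projection -` T \<and> (\<forall>u\<in>v. openin (top_of_set ?S) u) \<and>
           pairwise disjnt v \<and> (\<forall>u\<in>v. \<exists>q. homeomorphism u T line_projection q))"
    using AT openT openH by (intro exI[of _ T] conjI exI[of _ "{H 1, H (- 1)}"]) auto
qed

section \<open>Lifting paths and maps through the double cover\<close>

lemma proj_embed_in_image: "proj_embed P \<in> line_projection ` sphere 0 1"
proof -
  obtain x where x: "x \<in> sphere 0 1" "abs_proj_plane x = P" by (rule proj_plane_eq_abs_sphere)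
  moreover have "x \<noteq> 0" using x by auto
  ultimately show ?thesis using proj_embed_abs by blast
qed

lemma abs_proj_plane_eqI:
  assumes "x \<in> sphere 0 1" "line_projection x = proj_embed P"
  shows "abs_proj_plane x = P"
proof -
  have "x \<noteq> 0" using assms by auto
  then have "proj_embed (abs_proj_plane x) = proj_embed P" using assms proj_embed_abs by simp
  then show ?thesis by (rule injD[OF inj_proj_embed])
qed

lemma lift_path_to_sphere:
  assumes "path g"
  obtains c where "path c" "path_image c \<subseteq> sphere 0 1" "\<And>t. t \<in> {0..1} \<Longrightarrow> abs_proj_plane (c t) = g t"
proof -
  have "path (proj_embed \<circ> g)"
    by (intro path_continuous_image assms continuous_on_subset[OF continuous_on_proj_embed]) auto
  moreover have "path_image (proj_embed \<circ> g) \<subseteq> line_projection ` sphere 0 1"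
    using proj_embed_in_image by (auto simp: path_image_def)
  ultimately obtain c where c: "path c" "path_image c \<subseteq> sphere 0 1"
     "\<And>t. t \<in> {0..1} \<Longrightarrow> line_projection (c t) = (proj_embed \<circ> g) t"
    using covering_space_lift_path[OF covering_space_line_projection] by blast
  have "abs_proj_plane (c t) = g t" if "t \<in> {0..1}" for t
    using c(2) c(3)[OF that] that by (intro abs_proj_plane_eqI) (simp_all add: path_image_def image_subset_iff)
  with c that show ?thesis by blast
qed

text \<open>Since the plane is simply connected, the inverse of an affine chart lifts. This selects
  continuously one of the two antipodal points over each affine point and so carries planar paths to
  the sphere.\<close>

lemma lift_plane_to_sphere:
  fixes f :: "complex \<Rightarrow> proj_plane"
  assumes "continuous_on UNIV f"
  obtains s where "continuous_on UNIV s" "range s \<subseteq> sphere 0 1" "\<And>z. abs_proj_plane (s z) = f z"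
proof -
  have "continuous_on UNIV (proj_embed \<circ> f)"
    by (intro continuous_on_compose assms continuous_on_subset[OF continuous_on_proj_embed]) auto
  moreover have "proj_embed \<circ> f \<in> UNIV \<rightarrow> line_projection ` sphere 0 1"
    using proj_embed_in_image by auto
  moreover have "simply_connected (UNIV :: complex set)" "locally path_connected (UNIV :: complex set)"
    by (auto intro: convex_imp_simply_connected convex_imp_locally_path_connected)
  ultimately obtain s where s: "continuous_on UNIV s" "s \<in> UNIV \<rightarrow> sphere 0 1"
     "\<And>z. z \<in> UNIV \<Longrightarrow> line_projection (s z) = (proj_embed \<circ> f) z"
    using covering_space_lift[OF covering_space_line_projection] by metis
  have "abs_proj_plane (s z) = f z" for z
    using s(2) s(3)[of z] by (intro abs_proj_plane_eqI) auto
  with s that show ?thesis by blast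
qed

text \<open>The sphere is simply connected, and a contraction of the lifted loop projects to a
  contraction below. Hence the lift of a noncontractible loop cannot close up.\<close>

lemma loop_in_sphere_projects_to_contractible:
  fixes c :: "real \<Rightarrow> real^3"
  assumes "path c" "path_image c \<subseteq> sphere 0 1" "pathfinish c = pathstart c"
    and g: "\<And>t. t \<in> {0..1} \<Longrightarrow> abs_proj_plane (c t) = g t"
  shows "\<exists>a. homotopic_loops UNIV g (\<lambda>_. a)"
proof -
  have "simply_connected (sphere 0 1 :: (real^3) set)" by (simp add: simply_connected_sphere)
  moreover have "c 0 \<in> sphere 0 1" using assms(2) by (simp add: path_image_def image_subset_iff)
  ultimately have "homotopic_loops (sphere 0 1) c (linepath (c 0) (c 0))"
    using assms unfolding simply_connected_eq_contractible_loop_any by blast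
  then obtain h where h: "continuous_on ({0..1::real} \<times> {0..1}) h" "h \<in> {0..1} \<times> {0..1} \<rightarrow> sphere 0 1"
    "\<forall>x\<in>{0..1}. h (0, x) = c x" "\<forall>x\<in>{0..1}. h (1, x) = c 0"
    "\<forall>t\<in>{0..1}. pathfinish (h \<circ> Pair t) = pathstart (h \<circ> Pair t)"
    by (auto simp: homotopic_loops linepath_def algebra_simps simp flip: scaleR_left_distrib)
  have "continuous_on ({0..1} \<times> {0..1}) (abs_proj_plane \<circ> h)"
    by (intro continuous_on_compose h continuous_on_subset[OF continuous_on_abs_proj_plane_sphere])
      (use h(2) in auto)
  then have "homotopic_loops UNIV g (\<lambda>_. abs_proj_plane (c 0))"
    unfolding homotopic_loops using h g
    by (intro exI[of _ "abs_proj_plane \<circ> h"]) (auto simp: pathstart_def pathfinish_def)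
  then show ?thesis by blast
qed


section \<open>Crossing of pseudolines\<close>

text \<open>The ends of a lift lie over the same point and differ, so they are antipodal. The start
  may be placed over any point of \<open>p\<close>; later this will be the point at
  infinity.\<close>

lemma pseudoline_lift:
  assumes "pseudoline p" "y \<in> p"
  obtains c where "arc c" "path_image c \<subseteq> sphere 0 1" "pathfinish c = - pathstart c"
    "abs_proj_plane ` path_image c = p" "abs_proj_plane (pathstart c) = y"
    "inj_on (abs_proj_plane \<circ> c) {0..<1}"
proof -
  obtain g where g: "simple_path g" "pathfinish g = pathstart g" "path_image g = p"
    and nc: "\<nexists>a. homotopic_loops UNIV g (\<lambda>_. a)"
    using assms(1) unfolding pseudoline_def by blast
  obtain u where u: "u \<in> {0..1}" "g u = y" using assms(2) g(3) by (auto simp: path_image_def)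
  obtain b where b: "path b" "path_image b \<subseteq> sphere 0 1"
    and bg: "\<And>t. t \<in> {0..1} \<Longrightarrow> abs_proj_plane (b t) = g t"
    using lift_path_to_sphere simple_path_imp_path[OF g(1)] by blast
  have bS: "b t \<in> sphere 0 1" if "t \<in> {0..1}" for t using b(2) that unfolding path_image_def by blast
  have "b 1 \<noteq> b 0"
    using loop_in_sphere_projects_to_contractible[OF b _ bg] nc by (auto simp: pathstart_def pathfinish_def)
  moreover have "abs_proj_plane (b 1) = abs_proj_plane (b 0)"
    using bg g(2) by (simp add: pathstart_def pathfinish_def)
  ultimately have b10: "b 1 = - b 0" using bS abs_proj_plane_sphere_eq_iff[of "b 1" "b 0"] by auto
  \<comment> \<open>A lift of \<open>shiftpath u g\<close>: after \<open>b\<close> has reached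
    \<open>b 1 = - b 0\<close>, the antipodal copy of \<open>b\<close> continues it without a
    jump.\<close>
  define c where "c t = (if t \<le> 1 - u then b (u + t) else - b (u + t - 1))" for t
  have "continuous_on ({0..1-u} \<union> {1-u..1}) c"
    unfolding c_def
  proof (rule continuous_on_cases)
    have contb: "continuous_on {0..1} b" using b(1) by (simp add: path_def)
    show "continuous_on {0..1-u} (\<lambda>t. b (u + t))"
      using u(1) by (intro continuous_on_compose2[OF contb] continuous_intros) auto
    show "continuous_on {1-u..1} (\<lambda>t. - b (u + t - 1))"
      using u(1) by (intro continuous_on_minus continuous_on_compose2[OF contb] continuous_intros) auto
    show "\<forall>t. t \<in> {0..1-u} \<and> \<not> t \<le> 1 - u \<or> t \<in> {1-u..1} \<and> t \<le> 1 - u \<longrightarrow> b (u + t) = - b (u + t - 1)"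
    proof (intro allI impI)
      fix t assume "t \<in> {0..1-u} \<and> \<not> t \<le> 1 - u \<or> t \<in> {1-u..1} \<and> t \<le> 1 - u"
      then have "u + t = 1" by auto
      then show "b (u + t) = - b (u + t - 1)" using b10 by simp
    qed
  qed auto
  moreover have "{0..1-u} \<union> {1-u..1} = {0..1}" using u(1) by auto
  ultimately have pc: "path c" by (simp add: path_def)
  have cS: "c t \<in> sphere 0 1" if "t \<in> {0..1}" for t
    using bS[of "u + t"] bS[of "u + t - 1"] u(1) that by (auto simp: c_def)
  have cg: "abs_proj_plane (c t) = shiftpath u g t" if "t \<in> {0..1}" for t
    using u(1) that bS abs_proj_plane_minus by (auto simp: c_def shiftpath_alt_def bg)
  have c1: "c 1 = - c 0" using u(1) b10 by (auto simp: c_def)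
  have c0: "c 0 \<noteq> 0" using cS[of 0] by auto
  have free: "t = t' \<or> t = 0 \<and> t' = 1 \<or> t = 1 \<and> t' = 0"
    if "t \<in> {0..1}" "t' \<in> {0..1}" "abs_proj_plane (c t) = abs_proj_plane (c t')" for t t'
    using simple_path_shiftpath[OF g(1,2)] u(1) that cg
    unfolding simple_path_def loop_free_def by (metis atLeastAtMost_iff)
  show ?thesis
  proof
    show "arc c" unfolding arc_def
    proof (intro conjI pc inj_onI)
      fix t t' assume "t \<in> {0..1}" "t' \<in> {0..1}" "c t = c t'"
      moreover have "c 1 \<noteq> c 0" using c0 c1 neg_equal_0_iff_equal[of "c 0"] by (simp add: vec_eq_iff)
      ultimately show "t = t'" using free[of t t'] by metis
    qed
    show "path_image c \<subseteq> sphere 0 1" using cS by (auto simp: path_image_def)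
    show "pathfinish c = - pathstart c" using c1 by (simp add: pathstart_def pathfinish_def)
    have "abs_proj_plane ` path_image c = path_image (shiftpath u g)"
      unfolding path_image_def image_image using cg by (intro image_cong) auto
    then show "abs_proj_plane ` path_image c = p" using path_image_shiftpath[OF u(1) g(2)] g(3) by simp
    show "abs_proj_plane (pathstart c) = y"
      using cg[of 0] u by (simp add: pathstart_def shiftpath_def)
    show "inj_on (abs_proj_plane \<circ> c) {0..<1}"
      using free by (intro inj_onI) force
  qed
qed

text \<open>The chart \<open>h\<close> sends \<open>p0\<close> to infinity, and \<open>s\<close> is
  a continuous section of the double cover over the affine plane.\<close>

locale affine_chart =
  fixes p0 :: "proj_plane set" and h :: "proj_plane \<Rightarrow> complex" and h' s
  assumes homeo: "homeomorphism (- p0) UNIV h h'"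
    and cont_s: "continuous_on UNIV s" and s_sphere: "s z \<in> sphere 0 1"
    and abs_s: "abs_proj_plane (s z) = h' z"
begin

text \<open>A lift that starts and ends over infinity and runs in between on the sheet chosen by
  \<open>s\<close>. The last condition allows pieces of the lift to be joined to
  \<open>s\<close>-images of planar paths.\<close>

definition affine_lift :: "proj_plane set \<Rightarrow> (real \<Rightarrow> real^3) \<Rightarrow> bool" where
  "affine_lift p c \<longleftrightarrow> arc c \<and> path_image c \<subseteq> sphere 0 1 \<and> pathfinish c = - pathstart c \<and>
     abs_proj_plane ` path_image c = p \<and> abs_proj_plane (pathstart c) \<in> p0 \<and>
     inj_on (abs_proj_plane \<circ> c) {0..<1} \<and>
     (\<forall>t\<in>{0<..<1}. abs_proj_plane (c t) \<notin> p0 \<and> s (h (abs_proj_plane (c t))) = c t)"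

lemma h'_notin: "h' z \<notin> p0"
  using homeo unfolding homeomorphism_def by auto

lemma h_h' [simp]: "h (h' z) = z"
  using homeo unfolding homeomorphism_def by auto

lemma cont_h: "continuous_on (- p0) h"
  using homeo by (simp add: homeomorphism_def)

lemma h'_h: "x \<notin> p0 \<Longrightarrow> h' (h x) = x"
  using homeo unfolding homeomorphism_def by auto

lemma obtain_affine_lift:
  assumes p: "pseudoline p" and y: "p \<inter> p0 = {y}"
  obtains c where "affine_lift p c"
proof -
  obtain c where c: "arc c" "path_image c \<subseteq> sphere 0 1" "pathfinish c = - pathstart c"
    "abs_proj_plane ` path_image c = p" "abs_proj_plane (pathstart c) = y"
    "inj_on (abs_proj_plane \<circ> c) {0..<1}"
    using pseudoline_lift[OF p, of y] y by blast
  have cS: "c t \<in> sphere 0 1" if "t \<in> {0..1}" for t using c(2) that unfolding path_image_def by blast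
  have notp0: "abs_proj_plane (c t) \<notin> p0" if t: "t \<in> {0<..<1}" for t
  proof
    assume "abs_proj_plane (c t) \<in> p0"
    moreover have "abs_proj_plane (c t) \<in> p" using c(4) t by (auto simp: path_image_def)
    ultimately have "(abs_proj_plane \<circ> c) t = (abs_proj_plane \<circ> c) 0" using y c(5) by (auto simp: pathstart_def)
    then have "t = 0" using t by (intro inj_onD[OF c(6)]) auto
    with t show False by simp
  qed
  \<comment> \<open>For unit vectors that are equal or opposite, the inner product is the sign that
    relates them. Being continuous on an interval, the sign is constant, and multiplying
    \<open>c\<close> by it puts the lift on the sheet of \<open>s\<close>.\<close>
  define D where "D t = c t \<bullet> s (h (abs_proj_plane (c t)))" for t
  have Dval: "s (h (abs_proj_plane (c t))) = D t *\<^sub>R c t \<and> D t \<in> {1, -1}" if t: "t \<in> {0<..<1}" for t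
  proof -
    have "c t \<in> sphere 0 1" using cS t by simp
    moreover have "abs_proj_plane (s (h (abs_proj_plane (c t)))) = abs_proj_plane (c t)"
      using notp0[OF t] by (simp add: abs_s h'_h)
    ultimately have "s (h (abs_proj_plane (c t))) = c t \<or> s (h (abs_proj_plane (c t))) = - c t"
      using s_sphere abs_proj_plane_sphere_eq_iff by blast
    then show ?thesis using \<open>c t \<in> sphere 0 1\<close> by (auto simp: D_def dot_square_norm)
  qed
  have contc: "continuous_on {0<..<1} c" using arc_imp_path[OF c(1)] unfolding path_def
    by (rule continuous_on_subset) auto
  have "continuous_on {0<..<1} (\<lambda>t. abs_proj_plane (c t))"
    using cS by (intro continuous_on_compose2[OF continuous_on_abs_proj_plane_sphere contc]) auto
  from continuous_on_compose2[OF cont_h this]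
  have "continuous_on {0<..<1} (\<lambda>t. h (abs_proj_plane (c t)))" using notp0 by blast
  from continuous_on_compose2[OF cont_s this]
  have "continuous_on {0<..<1} D" unfolding D_def by (intro continuous_on_inner contc) auto
  then have "connected (D ` {0<..<1})" by (intro connected_continuous_image) auto
  moreover have "D ` {0<..<1} \<subseteq> {1, -1}" using Dval by blast
  moreover have "D (1/2) \<in> D ` {0<..<1}" by auto
  ultimately have const: "D ` {0<..<1} = {D (1/2)}"
    by (metis connected_finite_iff_sing empty_iff finite.simps finite_subset singletonD)
  define \<sigma> where "\<sigma> = D (1/2)"
  have \<sigma>: "\<sigma> = 1 \<or> \<sigma> = -1" using Dval[of "1/2"] by (auto simp: \<sigma>_def)
  have D\<sigma>: "D t = \<sigma>" if "t \<in> {0<..<1}" for t using const that by (auto simp: \<sigma>_def)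
  define d where "d t = \<sigma> *\<^sub>R c t" for t
  have abs_d: "abs_proj_plane (d t) = abs_proj_plane (c t)" if "t \<in> {0..1}" for t
    using \<sigma> abs_proj_plane_minus cS[OF that] by (auto simp: d_def)
  have "affine_lift p d" unfolding affine_lift_def
  proof (intro conjI ballI)
    have "path d" using arc_imp_path[OF c(1)] unfolding path_def d_def by (intro continuous_intros)
    moreover have "inj_on d {0..1}" using c(1) \<sigma> unfolding arc_def d_def inj_on_def by auto
    ultimately show "arc d" by (simp add: arc_def)
    show "path_image d \<subseteq> sphere 0 1" using cS \<sigma> by (auto simp: path_image_def d_def)
    show "pathfinish d = - pathstart d" using c(3) by (simp add: pathstart_def pathfinish_def d_def)
    have "abs_proj_plane ` path_image d = abs_proj_plane ` path_image c"
      unfolding path_image_def image_image by (intro image_cong refl abs_d)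
    then show "abs_proj_plane ` path_image d = p" using c(4) by simp
    show "abs_proj_plane (pathstart d) \<in> p0" using abs_d[of 0] c(5) y by (auto simp: pathstart_def)
    show "inj_on (abs_proj_plane \<circ> d) {0..<1}" using c(6) abs_d by (auto simp: inj_on_def)
  next
    fix t :: real assume t: "t \<in> {0<..<1}"
    then have "abs_proj_plane (d t) = abs_proj_plane (c t)" using abs_d by simp
    then show "abs_proj_plane (d t) \<notin> p0" "s (h (abs_proj_plane (d t))) = d t"
      using notp0[OF t] Dval[OF t] D\<sigma>[OF t] by (auto simp: d_def)
  qed
  then show ?thesis using that by blast
qed

context
  fixes p c assumes lift: "affine_lift p c"
begin

lemma affine_lift_sphere: "t \<in> {0..1} \<Longrightarrow> c t \<in> sphere 0 1"
  using lift unfolding affine_lift_def path_image_def by blast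

lemma affine_part_iff: "z \<in> h ` (p - p0) \<longleftrightarrow> h' z \<in> p"
proof
  show "h' z \<in> p \<Longrightarrow> z \<in> h ` (p - p0)"
    using h'_notin by (intro image_eqI[of _ _ "h' z"]) auto
qed (auto simp: h'_h)

lemma affine_part_eq: "h ` (p - p0) = (\<lambda>t. h (abs_proj_plane (c t))) ` {0<..<1}"
proof -
  have "p - p0 = (\<lambda>t. abs_proj_plane (c t)) ` {0<..<1}"
  proof
    show "(\<lambda>t. abs_proj_plane (c t)) ` {0<..<1} \<subseteq> p - p0"
      using lift by (auto simp: affine_lift_def path_image_def)
    show "p - p0 \<subseteq> (\<lambda>t. abs_proj_plane (c t)) ` {0<..<1}"
    proof
      fix x assume x: "x \<in> p - p0"
      then obtain t where t: "t \<in> {0..1}" "x = abs_proj_plane (c t)"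
        using lift by (auto simp: affine_lift_def path_image_def)
      have "c 1 = - c 0" "abs_proj_plane (c 0) \<in> p0"
        using lift by (auto simp: affine_lift_def pathstart_def pathfinish_def)
      then have "t \<noteq> 0" "t \<noteq> 1"
        using x t abs_proj_plane_minus[OF affine_lift_sphere, of 0] by auto
      with t show "x \<in> (\<lambda>t. abs_proj_plane (c t)) ` {0<..<1}" by auto
    qed
  qed
  then show ?thesis by (simp add: image_image)
qed

text \<open>\<open>p\<close> is the image of a compact arc, so its embedded image is compact and
  hence closed; the affine part is the preimage of that set under the continuous map
  \<open>proj_embed \<circ> h'\<close>.\<close>

lemma closed_affine_part: "closed (h ` (p - p0))"
proof -
  have "p = abs_proj_plane ` path_image c" using lift by (simp add: affine_lift_def)
  moreover have "proj_embed (abs_proj_plane x) = line_projection x" if "x \<in> path_image c" for x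
    using lift that by (intro proj_embed_abs) (auto simp: affine_lift_def)
  ultimately have "proj_embed ` p = line_projection ` path_image c" by (auto simp: image_image cong: image_cong)
  moreover have "compact (line_projection ` path_image c)"
  proof (rule compact_continuous_image)
    show "compact (path_image c)" using lift by (simp add: affine_lift_def compact_arc_image)
    show "continuous_on (path_image c) line_projection"
      by (rule continuous_on_subset[OF continuous_on_line_projection]) (use lift in \<open>auto simp: affine_lift_def\<close>)
  qed
  ultimately have "closed (proj_embed ` p)" by (simp add: compact_imp_closed)
  moreover have "continuous_on UNIV (proj_embed \<circ> h')"
    using homeo continuous_on_proj_embed
    by (intro continuous_on_compose) (auto simp: homeomorphism_def intro: continuous_on_subset)
  ultimately have "closed ((proj_embed \<circ> h') -` (proj_embed ` p))"
    by (simp add: closed_vimage continuous_on_closed_vimage)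
  moreover have "(proj_embed \<circ> h') -` (proj_embed ` p) = h ` (p - p0)"
    using affine_part_iff by (auto simp only: vimage_def mem_Collect_eq o_apply inj_image_mem_iff[OF inj_proj_embed])
  ultimately show ?thesis by simp
qed

text \<open>The open interval is not compact, so continuity of the inverse needs an argument:
  \<open>s\<close> leads back to the compact arc, where the inverse of \<open>c\<close> is
  continuous.\<close>

lemma homeomorphism_affine_part:
  "\<exists>f'. homeomorphism {0<..<1} (h ` (p - p0)) (\<lambda>t. h (abs_proj_plane (c t))) f'"
proof -
  let ?f = "\<lambda>t. h (abs_proj_plane (c t))"
  have "arc c" using lift by (simp add: affine_lift_def)
  then obtain c' where c': "homeomorphism {0..1} (path_image c) c c'" by (rule homeomorphism_arc)
  have contc: "continuous_on {0<..<1} c" using arc_imp_path[OF \<open>arc c\<close>] unfolding path_def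
    by (rule continuous_on_subset) auto
  have contf: "continuous_on {0<..<1} ?f"
  proof -
    have "continuous_on {0<..<1} (\<lambda>t. abs_proj_plane (c t))"
      using affine_lift_sphere
      by (intro continuous_on_compose2[OF continuous_on_abs_proj_plane_sphere contc]) auto
    from continuous_on_compose2[OF cont_h this] show ?thesis
      using lift by (auto simp: affine_lift_def)
  qed
  have sf: "s (?f t) = c t" if "t \<in> {0<..<1}" for t using lift that by (simp add: affine_lift_def)
  have sl: "s ` h ` (p - p0) \<subseteq> path_image c"
    unfolding affine_part_eq by (auto simp: sf path_image_def)
  have c'c: "c' (c t) = t" if "t \<in> {0..1}" for t using c' that by (simp add: homeomorphism_def)
  have "homeomorphism {0<..<1} (h ` (p - p0)) ?f (c' \<circ> s)"
  proof
    show "continuous_on {0<..<1} ?f" by (rule contf)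
    show "continuous_on (h ` (p - p0)) (c' \<circ> s)"
      using c' sl cont_s by (intro continuous_on_compose) (auto simp: homeomorphism_def intro: continuous_on_subset)
  qed (auto simp: affine_part_eq sf c'c)
  then show ?thesis by blast
qed

end

text \<open>The two rays of \<open>q\<close> that leave its crossing with \<open>p\<close> join, through the point of \<open>q\<close> at
  infinity, a point over the first ray to the antipode of a point over the second. A path in the
  complement of \<open>p\<close> between the rays would complete them to a symmetric connected set
  in the sphere that avoids the lift of \<open>p\<close>.\<close>

lemma rays_separated:
  assumes p: "affine_lift p b" and q: "affine_lift q c"
    and pq: "p \<inter> q = {x}" and u: "h (abs_proj_plane (c u)) \<in> h ` (p - p0)"
    and tuv: "0 < t" "t < u" "u < v" "v < 1"
  shows "\<not> connected_component (- (h ` (p - p0))) (h (abs_proj_plane (c t))) (h (abs_proj_plane (c v)))"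
proof
  let ?l = "h ` (p - p0)"
  let ?f = "\<lambda>t. h (abs_proj_plane (c t))"
  assume "connected_component (- ?l) (?f t) (?f v)"
  \<comment> \<open>A path is wanted, and not just a connected set, because its image is compact; so
    \<open>K\<close> will be compact too.\<close>
  moreover have "open (- ?l)" using closed_affine_part[OF p] by (simp add: open_Compl)
  ultimately have "path_component (- ?l) (?f t) (?f v)"
    by (simp add: open_path_connected_component)
  then obtain r where r: "path r" "path_image r \<subseteq> - ?l" "pathstart r = ?f t" "pathfinish r = ?f v"
    unfolding path_component_def by blast
  have arcc: "arc c" using q by (auto simp: affine_lift_def)
  have c1: "c 1 = - c 0" using q by (auto simp: affine_lift_def pathstart_def pathfinish_def)
  have sf: "s (?f t) = c t" if "t \<in> {0<..<1}" for t using q that by (simp add: affine_lift_def)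
  have contc: "continuous_on {0..1} c" using arc_imp_path[OF arcc] by (simp add: path_def)
  \<comment> \<open>A connected set from \<open>c 0\<close> along the first ray to
    \<open>c t\<close>, over \<open>r\<close> to \<open>c v\<close>, and along the second ray to
    \<open>c 1 = - c 0\<close>. Its antipodal copy shares the point \<open>c 1\<close> with it, so
    the union \<open>K\<close> is connected and symmetric.\<close>
  define X where "X = c ` {0..t} \<union> s ` path_image r \<union> c ` {v..1}"
  define K where "K = X \<union> uminus ` X"
  have cpt: "compact (c ` {0..t})" "compact (c ` {v..1})" "compact (s ` path_image r)"
    using tuv r(1) contc cont_s compact_path_image
    by (auto intro!: compact_continuous_image intro: continuous_on_subset)
  have con: "connected (c ` {0..t})" "connected (c ` {v..1})" "connected (s ` path_image r)"
    using tuv r(1) contc cont_s connected_path_image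
    by (auto intro!: connected_continuous_image intro: continuous_on_subset)
  have st: "s (pathstart r) = c t" "s (pathfinish r) = c v" using r sf tuv by auto
  have "c t \<in> c ` {0..t} \<inter> s ` path_image r" "c v \<in> s ` path_image r \<inter> c ` {v..1}"
    using tuv st pathstart_in_path_image[of r] pathfinish_in_path_image[of r] by (auto, metis imageI, metis imageI)
  then have "connected X" unfolding X_def using con
    by (intro connected_Un) auto
  have Xc: "c 0 \<in> X" "c 1 \<in> X" using tuv by (auto simp: X_def)
  have XS: "X \<subseteq> sphere 0 1" using affine_lift_sphere[OF q] tuv s_sphere by (auto simp: X_def)
  have "compact X" unfolding X_def using cpt by (intro compact_Un)
  have contm: "continuous_on X uminus" by (intro continuous_intros)
  have X_disj: "abs_proj_plane z \<notin> p" if zX: "z \<in> X" for z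
  proof -
    have x: "x = abs_proj_plane (c u)"
    proof -
      have "abs_proj_plane (c u) \<in> q" "abs_proj_plane (c u) \<notin> p0"
        using q tuv by (auto simp: affine_lift_def path_image_def)
      moreover have "abs_proj_plane (c u) \<in> p"
        using u affine_part_iff[OF p] h'_h \<open>abs_proj_plane (c u) \<notin> p0\<close> by metis
      ultimately show ?thesis using pq by auto
    qed
    have inj: "inj_on (abs_proj_plane \<circ> c) {0..<1}" using q by (simp add: affine_lift_def)
    have cin: "abs_proj_plane (c w) \<in> q" if "w \<in> {0..1}" for w
      using q that by (auto simp: affine_lift_def path_image_def)
    have less: "abs_proj_plane (c w) \<notin> p" if "w \<in> {0..<1}" "w \<noteq> u" for w
    proof
      assume "abs_proj_plane (c w) \<in> p"
      then have "(abs_proj_plane \<circ> c) w = (abs_proj_plane \<circ> c) u" using cin[of w] that pq x by auto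
      then have "w = u" using that tuv by (intro inj_onD[OF inj]) auto
      with that show False by simp
    qed
    \<comment> \<open>Parameter 1 lies outside the range of injectivity, but \<open>c 1\<close> lies
      over the same point as \<open>c 0\<close>.\<close>
    have one: "abs_proj_plane (c 1) \<notin> p"
      using less[of 0] tuv abs_proj_plane_minus[OF affine_lift_sphere[OF q], of 0] c1 by auto
    consider w where "w \<in> {0..t} \<union> {v..1}" "z = c w" | w where "w \<in> path_image r" "z = s w"
      using zX unfolding X_def by blast
    then show ?thesis
    proof cases
      case 1
      then show ?thesis using less[of w] one tuv by (cases "w = 1") auto
    next
      case 2
      then show ?thesis using r(2) affine_part_iff[OF p] abs_s by auto
    qed
  qed
  have "K \<inter> path_image b \<noteq> {}"
  proof (rule symmetric_connected_meets_path)
    show "arc b" "path_image b \<subseteq> sphere 0 1" "pathfinish b = - pathstart b"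
      using p by (auto simp: affine_lift_def)
    have "c 1 \<in> X \<inter> uminus ` X" using Xc c1 by auto
    moreover have "connected (uminus ` X)" using \<open>connected X\<close> contm by (rule connected_continuous_image[rotated])
    ultimately show "connected K" unfolding K_def using \<open>connected X\<close> by (intro connected_Un) auto
    show "compact K" unfolding K_def using \<open>compact X\<close> contm by (intro compact_Un compact_continuous_image)
    show "K \<noteq> {}" "K \<subseteq> sphere 0 1" using Xc XS by (auto simp: K_def)
    show "\<And>z. z \<in> K \<Longrightarrow> - z \<in> K" by (auto simp: K_def)
  qed
  then obtain z where z: "z \<in> K" "z \<in> path_image b" by blast
  then have "abs_proj_plane z \<in> p" using p by (auto simp: affine_lift_def)
  moreover have "z \<in> sphere 0 1" using z(2) p by (auto simp: affine_lift_def)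
  moreover have "z \<in> X \<or> - z \<in> X" using z(1) by (auto simp: K_def)
  ultimately show False using X_disj[of z] X_disj[of "- z"] abs_proj_plane_minus[of z] by auto
qed

end

text \<open>This collects what the planar argument needs from the projective setting; in the last
  clause, crossing reads as separation of the two rays.\<close>

lemma Euclidean_arrangement_structure:
  assumes "Euclidean_arrangement L"
  shows "finite L" "pairwise (\<lambda>l m. \<exists>!x. x \<in> l \<inter> m) L" "\<And>l. l \<in> L \<Longrightarrow> closed l"
    "\<exists>f f'. (\<forall>l\<in>L. homeomorphism {0<..<1::real} l (f l) (f' l)) \<and>
       (\<forall>l\<in>L. \<forall>m\<in>L. \<forall>t u v. l \<noteq> m \<and> 0 < t \<and> t < u \<and> u < v \<and> v < 1 \<and> f m u \<in> l \<longrightarrow>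
          \<not> connected_component (- l) (f m t) (f m v))"
proof -
  obtain P p0 h h' where P: "projective_arrangement P" "p0 \<in> P" and homeo: "homeomorphism (- p0) UNIV h h'"
    and L: "L = (\<lambda>p. h ` (p - p0)) ` (P - {p0})"
    using assms unfolding Euclidean_arrangement_def by blast
  show "pairwise (\<lambda>l m. \<exists>!x. x \<in> l \<inter> m) L" using assms unfolding Euclidean_arrangement_def by blast
  show "finite L" using P by (simp add: L projective_arrangement_def)
  have "continuous_on UNIV h'" using homeo by (simp add: homeomorphism_def)
  then obtain s where "continuous_on UNIV s" "range s \<subseteq> sphere 0 1" "\<And>z. abs_proj_plane (s z) = h' z"
    using lift_plane_to_sphere by blast
  then interpret affine_chart p0 h h' s
    using homeo by unfold_locales (auto simp: image_subset_iff simp del: mem_sphere)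
  have "\<exists>c. affine_lift p c" if "p \<in> P - {p0}" for p
  proof -
    have "\<exists>!x. x \<in> p \<inter> p0" "pseudoline p"
      using P that by (auto simp: projective_arrangement_def pairwise_def)
    then show ?thesis using obtain_affine_lift by (metis singleton_iff subsetI subset_antisym empty_subsetI insert_subset)
  qed
  then obtain C where C: "\<And>p. p \<in> P - {p0} \<Longrightarrow> affine_lift p (C p)" by metis
  show "closed l" if "l \<in> L" for l using that closed_affine_part C by (auto simp: L)
  \<comment> \<open>\<open>pr\<close> chooses a projective pseudoline for each affine one; distinct
    affine lines necessarily receive distinct ones.\<close>
  have "\<exists>p. p \<in> P - {p0} \<and> l = h ` (p - p0)" if "l \<in> L" for l using that by (auto simp: L)
  then obtain pr where pr: "\<And>l. l \<in> L \<Longrightarrow> pr l \<in> P - {p0}" "\<And>l. l \<in> L \<Longrightarrow> h ` (pr l - p0) = l" by metis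
  define f where "f l t = h (abs_proj_plane (C (pr l) t))" for l t
  have "\<exists>f'. homeomorphism {0<..<1} l (f l) f'" if "l \<in> L" for l
    using homeomorphism_affine_part[OF C, OF pr(1)[OF that]] pr(2)[OF that] by (simp add: f_def[abs_def])
  then obtain f' where "\<And>l. l \<in> L \<Longrightarrow> homeomorphism {0<..<1} l (f l) (f' l)" by metis
  moreover have "\<not> connected_component (- l) (f m t) (f m v)"
    if "l \<in> L" "m \<in> L" "l \<noteq> m" "0 < t" "t < u" "u < v" "v < 1" "f m u \<in> l" for l m t u v
  proof -
    have "pr l \<noteq> pr m" using pr(2) that by metis
    then have "\<exists>!x. x \<in> pr l \<inter> pr m"
      using P pr(1) that by (auto simp: projective_arrangement_def pairwise_def)
    then obtain x where "pr l \<inter> pr m = {x}" by auto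
    then show ?thesis
      using rays_separated[OF C[OF pr(1)] C[OF pr(1)], OF that(1,2)] that pr(2) by (simp add: f_def)
  qed
  ultimately show "\<exists>f f'. (\<forall>l\<in>L. homeomorphism {0<..<1::real} l (f l) (f' l)) \<and>
       (\<forall>l\<in>L. \<forall>m\<in>L. \<forall>t u v. l \<noteq> m \<and> 0 < t \<and> t < u \<and> u < v \<and> v < 1 \<and> f m u \<in> l \<longrightarrow>
          \<not> connected_component (- l) (f m t) (f m v))"
    by blast
qed


section \<open>Pasch's axiom and uncrossed triangles\<close>

lemma open_segment_real_iff: "x \<in> open_segment a b \<longleftrightarrow> a < x \<and> x < b \<or> b < x \<and> x < a" for x :: real
  by (auto simp: open_segment_eq_real_ivl)

text \<open>The parameter turns betweenness on a line into the order of the reals;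
  \<open>separated\<close> ties it to the topology of the plane.\<close>

locale parametrised_arrangement =
  fixes L :: "complex set set" and f :: "complex set \<Rightarrow> real \<Rightarrow> complex" and f'
  assumes finite_L: "finite L"
    and unique: "pairwise (\<lambda>l m. \<exists>!x. x \<in> l \<inter> m) L"
    and closed_line: "l \<in> L \<Longrightarrow> closed l"
    and homeo: "l \<in> L \<Longrightarrow> homeomorphism {0<..<1} l (f l) (f' l)"
    and separated: "\<lbrakk>l \<in> L; m \<in> L; l \<noteq> m; 0 < t; t < u; u < v; v < 1; f m u \<in> l\<rbrakk>
      \<Longrightarrow> \<not> connected_component (- l) (f m t) (f m v)"
    and simple: "simple_arrangement L"
begin

section \<open>Crossings and segments of lines\<close>

definition crossing :: "complex set \<Rightarrow> complex set \<Rightarrow> complex" where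
  "crossing l m = (THE x. x \<in> l \<inter> m)"

definition seg :: "complex set \<Rightarrow> complex \<Rightarrow> complex \<Rightarrow> complex set" where
  "seg l a b = f l ` open_segment (f' l a) (f' l b)"

lemma f_f' [simp]: "l \<in> L \<Longrightarrow> x \<in> l \<Longrightarrow> f l (f' l x) = x"
  and f'_f [simp]: "l \<in> L \<Longrightarrow> 0 < t \<Longrightarrow> t < 1 \<Longrightarrow> f' l (f l t) = t"
  and f_in: "l \<in> L \<Longrightarrow> 0 < t \<Longrightarrow> t < 1 \<Longrightarrow> f l t \<in> l"
  and f'_in: "l \<in> L \<Longrightarrow> x \<in> l \<Longrightarrow> 0 < f' l x \<and> f' l x < 1"
  and cont_f: "l \<in> L \<Longrightarrow> continuous_on {0<..<1} (f l)"
  and cont_f': "l \<in> L \<Longrightarrow> continuous_on l (f' l)"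
  using homeo[of l] unfolding homeomorphism_def by force+

lemma f'_eq_iff: "l \<in> L \<Longrightarrow> x \<in> l \<Longrightarrow> y \<in> l \<Longrightarrow> f' l x = f' l y \<longleftrightarrow> x = y"
  by (metis f_f')

lemma crossing_in:
  assumes "l \<in> L" "m \<in> L" "l \<noteq> m"
  shows "crossing l m \<in> l" "crossing l m \<in> m"
proof -
  have "\<exists>!x. x \<in> l \<inter> m" using unique assms by (auto simp: pairwise_def)
  then have "crossing l m \<in> l \<inter> m" unfolding crossing_def by (rule theI')
  then show "crossing l m \<in> l" "crossing l m \<in> m" by auto
qed

lemma crossing_unique:
  assumes "l \<in> L" "m \<in> L" "l \<noteq> m" "x \<in> l" "x \<in> m"
  shows "x = crossing l m"
proof -
  have "\<exists>!x. x \<in> l \<inter> m" using unique assms by (auto simp: pairwise_def)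
  then show ?thesis using assms crossing_in by blast
qed

lemma crossing_commute: "crossing l m = crossing m l"
  by (simp add: crossing_def Int_commute)

text \<open>Simplicity of the arrangement enters here.\<close>

lemma crossing_notin:
  assumes "l \<in> L" "m \<in> L" "k \<in> L" "l \<noteq> m" "k \<noteq> l" "k \<noteq> m"
  shows "crossing l m \<notin> k"
proof
  assume "crossing l m \<in> k"
  then have "{l, m, k} \<subseteq> {l' \<in> L. crossing l m \<in> l'}" using assms crossing_in by auto
  then have "card {l, m, k} \<le> card {l' \<in> L. crossing l m \<in> l'}"
    using finite_L by (intro card_mono) auto
  also have "\<dots> \<le> 2" using simple unfolding simple_arrangement_def by blast
  finally show False using assms by auto
qed

lemma crossing_inj:
  assumes "l \<in> L" "m \<in> L" "k \<in> L" "l \<noteq> m" "k \<noteq> l" "crossing l m = crossing l k"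
  shows "m = k"
  using assms crossing_notin crossing_in(2) by metis

lemma mem_seg:
  assumes "l \<in> L" "a \<in> l" "b \<in> l"
  shows "x \<in> seg l a b \<longleftrightarrow> x \<in> l \<and> f' l x \<in> open_segment (f' l a) (f' l b)"
proof -
  have "0 < t \<and> t < 1" if "t \<in> open_segment (f' l a) (f' l b)" for t
    using that f'_in[of l a] f'_in[of l b] assms by (auto simp: open_segment_real_iff)
  then show ?thesis unfolding seg_def using assms(1) by (force simp: f_in)
qed

lemma seg_commute: "seg l a b = seg l b a"
  by (simp add: seg_def open_segment_commute)

lemma endpoints_notin_seg:
  assumes "l \<in> L" "a \<in> l" "b \<in> l"
  shows "a \<notin> seg l a b" "b \<notin> seg l a b"
  using assms by (simp_all add: mem_seg open_segment_real_iff)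

lemma seg_mono:
  assumes "l \<in> L" "a \<in> l" "b \<in> l" "c \<in> seg l a b \<union> {a, b}" "d \<in> seg l a b \<union> {a, b}"
  shows "seg l c d \<subseteq> seg l a b"
proof -
  have "f' l c \<in> closed_segment (f' l a) (f' l b)" "f' l d \<in> closed_segment (f' l a) (f' l b)"
    using assms by (auto simp: mem_seg open_segment_def)
  then have "open_segment (f' l c) (f' l d) \<subseteq> open_segment (f' l a) (f' l b)"
    by (auto simp: open_segment_eq_real_ivl closed_segment_eq_real_ivl split: if_splits)
  then show ?thesis unfolding seg_def by (rule image_mono)
qed

lemma closed_segment_f'_sub:
  assumes "l \<in> L" "a \<in> l" "b \<in> l"
  shows "closed_segment (f' l a) (f' l b) \<subseteq> {0<..<1}"
  using f'_in[of l a] f'_in[of l b] assms by (auto simp: closed_segment_eq_real_ivl split: if_splits)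

lemma f_closed_segment:
  assumes "l \<in> L" "a \<in> l" "b \<in> l"
  shows "f l ` closed_segment (f' l a) (f' l b) = seg l a b \<union> {a, b}"
proof -
  have "closed_segment (f' l a) (f' l b) = open_segment (f' l a) (f' l b) \<union> {f' l a, f' l b}"
    by (simp add: closed_segment_eq_open)
  then show ?thesis using assms by (simp add: seg_def image_Un)
qed

text \<open>Betweenness on \<open>m\<close> becomes a statement about the complement of
  \<open>k\<close> that no longer mentions \<open>m\<close>, so it can be compared across lines. If
  the crossing is not in the segment, the closed segment itself joins \<open>a\<close> to
  \<open>b\<close> without meeting \<open>k\<close>.\<close>

lemma crossing_in_seg_iff:
  assumes "m \<in> L" "k \<in> L" "m \<noteq> k" "a \<in> m" "b \<in> m" "a \<notin> k" "b \<notin> k"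
  shows "crossing m k \<in> seg m a b \<longleftrightarrow> \<not> connected_component (- k) a b"
proof -
  let ?x = "crossing m k"
  have x: "?x \<in> m" "?x \<in> k" using crossing_in assms by auto
  have sep: "\<not> connected_component (- k) a b"
    if "f' m a < f' m ?x" "f' m ?x < f' m b" "a \<in> m" "b \<in> m" for a b
    using separated[of k m "f' m a" "f' m ?x" "f' m b"] that x assms f'_in[of m a] f'_in[of m b] by auto
  show ?thesis
  proof
    assume "?x \<in> seg m a b"
    then show "\<not> connected_component (- k) a b"
      using sep[of a b] sep[of b a] assms connected_component_sym
      by (auto simp: mem_seg open_segment_real_iff)
  next
    assume nc: "\<not> connected_component (- k) a b"
    show "?x \<in> seg m a b"
    proof (rule ccontr)
      assume notin: "?x \<notin> seg m a b"
      let ?C = "f m ` closed_segment (f' m a) (f' m b)"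
      have "connected ?C"
        using continuous_on_subset[OF cont_f[OF assms(1)] closed_segment_f'_sub] assms
        by (intro connected_continuous_image) auto
      moreover have C: "?C = seg m a b \<union> {a, b}" using assms by (intro f_closed_segment)
      moreover have "?C \<subseteq> - k"
      proof -
        have "y \<notin> k" if "y \<in> seg m a b" for y
          using that notin crossing_unique[of m k y] assms by (auto simp: mem_seg)
        then show ?thesis using assms unfolding C by auto
      qed
      ultimately have "connected_component (- k) a b"
        unfolding connected_component_def by (intro exI[of _ ?C]) auto
      with nc show False by simp
    qed
  qed
qed

text \<open>Lying in the same component of the complement of \<open>k\<close> is transitive, so if
  \<open>k\<close> separates two vertices, it separates the third one from at least one of
  them.\<close>

lemma Pasch:
  assumes "l \<in> L" "i \<in> L" "j \<in> L" "k \<in> L" "l \<noteq> i" "l \<noteq> j" "i \<noteq> j" "k \<noteq> l" "k \<noteq> i" "k \<noteq> j"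
    and cross: "crossing l k \<in> seg l (crossing l i) (crossing l j)"
  shows "crossing i k \<in> seg i (crossing i l) (crossing i j) \<or>
         crossing j k \<in> seg j (crossing j l) (crossing j i)"
proof -
  have "\<not> connected_component (- k) (crossing l i) (crossing l j)"
    using cross assms crossing_in crossing_notin by (subst (asm) crossing_in_seg_iff) auto
  then have "\<not> connected_component (- k) (crossing i l) (crossing i j) \<or>
      \<not> connected_component (- k) (crossing j l) (crossing j i)"
    by (metis connected_component_sym connected_component_trans crossing_commute)
  moreover have "crossing i k \<in> seg i (crossing i l) (crossing i j) \<longleftrightarrow>
      \<not> connected_component (- k) (crossing i l) (crossing i j)"
    using assms crossing_in crossing_notin by (intro crossing_in_seg_iff) auto
  moreover have "crossing j k \<in> seg j (crossing j l) (crossing j i) \<longleftrightarrow>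
      \<not> connected_component (- k) (crossing j l) (crossing j i)"
    using assms crossing_in crossing_notin by (intro crossing_in_seg_iff) auto
  ultimately show ?thesis by blast
qed

definition uncrossed :: "complex set \<Rightarrow> complex \<Rightarrow> complex \<Rightarrow> bool" where
  "uncrossed l a b \<longleftrightarrow> (\<forall>k\<in>L - {l}. crossing l k \<notin> seg l a b)"

text \<open>Take the crossing nearest to \<open>l\<close> in the parameter of \<open>i\<close> among
  those up to \<open>j\<close>. Including \<open>j\<close> itself among the candidates makes the set
  nonempty.\<close>

lemma first_crossing:
  assumes "i \<in> L" "l \<in> L" "j \<in> L" "i \<noteq> l" "i \<noteq> j" "l \<noteq> j"
  obtains k where "k \<in> L" "k \<noteq> i" "k \<noteq> l" "uncrossed i (crossing i l) (crossing i k)"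
    "k = j \<or> crossing i k \<in> seg i (crossing i l) (crossing i j)"
proof -
  define S where "S = {k \<in> L - {i, l}. k = j \<or> crossing i k \<in> seg i (crossing i l) (crossing i j)}"
  define d where "d k = \<bar>f' i (crossing i k) - f' i (crossing i l)\<bar>" for k
  have "finite S" "S \<noteq> {}" using finite_L assms by (auto simp: S_def)
  then obtain k where k: "k \<in> S" "\<And>k'. k' \<in> S \<Longrightarrow> d k \<le> d k'"
    using arg_min_if_finite[of S d] by (metis linorder_not_less)
  have il: "crossing i l \<in> i" "crossing i j \<in> i" "crossing i k \<in> i"
    using crossing_in assms k(1) by (auto simp: S_def)
  have "uncrossed i (crossing i l) (crossing i k)"
    unfolding uncrossed_def
  proof (intro ballI notI)
    fix k' assume k': "k' \<in> L - {i}" "crossing i k' \<in> seg i (crossing i l) (crossing i k)"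
    then have "k' \<noteq> l" using il assms by (auto simp: mem_seg open_segment_real_iff)
    moreover have "crossing i k' \<in> seg i (crossing i l) (crossing i j)"
      using k'(2) k(1) il assms by (auto simp: mem_seg open_segment_real_iff S_def)
    ultimately have "k' \<in> S" using k' by (auto simp: S_def)
    then have "d k \<le> d k'" by (rule k(2))
    moreover have "d k' < d k"
      using k'(2) il assms by (auto simp: mem_seg open_segment_real_iff d_def)
    ultimately show False by simp
  qed
  then show ?thesis using that k(1) by (auto simp: S_def)
qed

text \<open>Among the pairs \<open>(i, j)\<close> such that \<open>j\<close> is the first line that \<open>i\<close> meets when it leaves \<open>l\<close>
  in one of the two directions, take one whose base on \<open>l\<close> contains the fewest crossings. A line
  \<open>k\<close> through that base would leave the triangle through \<open>j\<close>, and the first line that it meets on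
  the way also comes from the base, or is \<open>j\<close>. This is a pair with a smaller base.\<close>

lemma exists_uncrossed_triangle:
  assumes l: "l \<in> L" and card: "card L \<ge> 3"
  obtains i j where "i \<in> L" "j \<in> L" "l \<noteq> i" "l \<noteq> j" "i \<noteq> j"
    "uncrossed l (crossing l i) (crossing l j)" "uncrossed i (crossing i l) (crossing i j)"
    "uncrossed j (crossing j l) (crossing j i)"
proof -
  define Q where "Q = {(i, j). i \<in> L \<and> j \<in> L \<and> l \<noteq> i \<and> l \<noteq> j \<and> i \<noteq> j \<and>
    uncrossed i (crossing i l) (crossing i j)}"
  define B where "B = (\<lambda>(i, j). {k \<in> L - {l}. crossing l k \<in> seg l (crossing l i) (crossing l j)})"
  have finB: "finite (B q)" for q using finite_L by (auto simp: B_def split: prod.split)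
  have "card (L - {l}) \<ge> 2" using card l finite_L by (simp add: card_Diff_singleton)
  then obtain S where "S \<subseteq> L - {l}" "card S = 2" by (meson obtain_subset_with_card_n)
  then obtain i0 j0 where "i0 \<in> L - {l}" "j0 \<in> L - {l}" "i0 \<noteq> j0"
    unfolding card_2_iff by auto
  then obtain k0 where "(i0, k0) \<in> Q"
    using first_crossing[of i0 l j0] l by (auto simp: Q_def)
  then have "Q \<noteq> {}" by blast
  moreover have "finite Q" by (rule finite_subset[of _ "L \<times> L"]) (auto simp: Q_def finite_L)
  ultimately obtain q where q: "q \<in> Q" "\<And>q'. q' \<in> Q \<Longrightarrow> card (B q) \<le> card (B q')"
    using arg_min_if_finite[of Q "\<lambda>q. card (B q)"] by (metis linorder_not_less)
  obtain i j where ij: "q = (i, j)" by fastforce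
  have mem: "i \<in> L" "j \<in> L" "l \<noteq> i" "l \<noteq> j" "i \<noteq> j" and free: "uncrossed i (crossing i l) (crossing i j)"
    using q(1) by (auto simp: Q_def ij)
  note in_l = crossing_in(1)[OF l]
  have lij: "crossing l i \<in> l" "crossing l j \<in> l" using in_l mem by auto
  have base: "uncrossed l (crossing l i) (crossing l j)"
    unfolding uncrossed_def
  proof (intro ballI notI)
    fix k assume k: "k \<in> L - {l}" and kb: "crossing l k \<in> seg l (crossing l i) (crossing l j)"
    have "k \<noteq> i" "k \<noteq> j"
      using kb endpoints_notin_seg[OF l lij] by metis+
    then have kj: "crossing j k \<in> seg j (crossing j l) (crossing j i)"
      using Pasch[OF l mem(1,2) _ mem(3-5), of k] kb k free mem by (auto simp: uncrossed_def)
    obtain k' where k': "k' \<in> L" "k' \<noteq> k" "k' \<noteq> l" "uncrossed k (crossing k l) (crossing k k')"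
      "k' = j \<or> crossing k k' \<in> seg k (crossing k l) (crossing k j)"
      using first_crossing[of k l j] k l mem \<open>k \<noteq> j\<close> by blast
    have "(k, k') \<in> Q" using k k' by (auto simp: Q_def)
    have "k' = j \<or> crossing l k' \<in> seg l (crossing l i) (crossing l j)"
    proof (cases "k' = j")
      case False
      then have "crossing k k' \<in> seg k (crossing k l) (crossing k j)" using k'(5) by blast
      \<comment> \<open>Pasch for the triangle of \<open>k\<close>, \<open>l\<close>,
        \<open>j\<close>: \<open>k'\<close> leaves it through the base or through \<open>j\<close>.
        In the second case Pasch for the triangle of \<open>j\<close>, \<open>l\<close>,
        \<open>i\<close>, whose side on \<open>i\<close> is uncrossed, brings \<open>k'\<close> back
        to the base.\<close>
      then have "crossing l k' \<in> seg l (crossing l k) (crossing l j) \<or>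
          crossing j k' \<in> seg j (crossing j k) (crossing j l)"
        using Pasch[of k l j k'] k k' l mem False \<open>k \<noteq> j\<close> by auto
      then show ?thesis
      proof
        assume "crossing l k' \<in> seg l (crossing l k) (crossing l j)"
        then have "crossing l k' \<in> seg l (crossing l i) (crossing l j)"
          using seg_mono[OF l lij, of "crossing l k" "crossing l j"] kb by blast
        then show ?thesis ..
      next
        assume jk': "crossing j k' \<in> seg j (crossing j k) (crossing j l)"
        have in_j: "crossing j l \<in> j" "crossing j i \<in> j"
          using crossing_in(1) mem l by auto
        have jk'': "crossing j k' \<in> seg j (crossing j l) (crossing j i)"
          using seg_mono[OF mem(2) in_j, of "crossing j k" "crossing j l"] kj jk' by blast
        have "k' \<noteq> i"
          using jk'' endpoints_notin_seg[OF mem(2) in_j] by metis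
        have "crossing l k' \<in> seg l (crossing l j) (crossing l i) \<or>
            crossing i k' \<in> seg i (crossing i j) (crossing i l)"
          using Pasch[of j l i k'] jk'' k' l mem False \<open>k' \<noteq> i\<close> by metis
        moreover have "crossing i k' \<notin> seg i (crossing i j) (crossing i l)"
          using free k' \<open>k' \<noteq> i\<close> by (auto simp: uncrossed_def seg_commute)
        ultimately show ?thesis by (auto simp: seg_commute)
      qed
    qed simp
    \<comment> \<open>The new base lies within the old one and loses at least the crossing with
      \<open>k\<close>, which is now an end point.\<close>
    then have "seg l (crossing l k) (crossing l k') \<subseteq> seg l (crossing l i) (crossing l j)"
      using kb by (intro seg_mono l lij) auto
    moreover have "crossing l k \<notin> seg l (crossing l k) (crossing l k')"
      using in_l k k' by (intro endpoints_notin_seg l) auto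
    ultimately have "B (k, k') \<subseteq> B (i, j) - {k}" by (auto simp: B_def)
    moreover have "k \<in> B (i, j)" using k kb by (auto simp: B_def)
    ultimately have "B (k, k') \<subset> B (i, j)" by blast
    then have "card (B (k, k')) < card (B q)" unfolding ij using finB by (intro psubset_card_mono)
    with q(2)[OF \<open>(k, k') \<in> Q\<close>] show False by simp
  qed
  \<comment> \<open>A line through the third side would, by Pasch, cross one of the other two, and
    both are uncrossed.\<close>
  have "uncrossed j (crossing j l) (crossing j i)"
    unfolding uncrossed_def
  proof (intro ballI notI)
    fix k assume k: "k \<in> L - {j}" and kb: "crossing j k \<in> seg j (crossing j l) (crossing j i)"
    have "crossing j l \<in> j" "crossing j i \<in> j" using crossing_in(1) mem l by auto
    then have "k \<noteq> l" "k \<noteq> i"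
      using kb endpoints_notin_seg[OF mem(2)] by metis+
    then show False
      using Pasch[of j l i k] kb k l mem base free by (auto simp: uncrossed_def seg_commute)
  qed
  then show ?thesis using that mem base free by blast
qed


section \<open>The cell bounded by an uncrossed triangle\<close>

text \<open>A ray is closed in the closed set \<open>l\<close>, hence closed in the plane. If
  bounded, it would be compact, and the inverse parametrisation would make a half-open interval
  compact.\<close>

lemma unbounded_rays:
  assumes "l \<in> L" "0 < t" "t < 1"
  shows "\<not> bounded (f l ` {0<..t})" "\<not> bounded (f l ` {t..<1})"
proof -
  have *: "compact I" if "bounded (f l ` I)" "I \<subseteq> {0<..<1}" "closedin (top_of_set {0<..<1}) I" for I
  proof -
    have "closedin (top_of_set l) (f l ` I)"
      using homeomorphism_imp_closed_map[OF homeo[OF assms(1)] that(3)] .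
    then have "closed (f l ` I)" using closed_line[OF assms(1)] closedin_closed_trans by blast
    then have "compact (f l ` I)" using that(1) by (simp add: compact_eq_bounded_closed)
    moreover have "f l ` I \<subseteq> l" using that(2) f_in[OF assms(1)] by auto
    ultimately have "compact (f' l ` (f l ` I))"
      using compact_continuous_image[OF continuous_on_subset[OF cont_f'[OF assms(1)]]] by blast
    moreover have "f' l ` f l ` I = I" using that(2) assms(1) by (force simp: image_image)
    ultimately show ?thesis by simp
  qed
  have "\<not> closed {0<..t}"
  proof
    assume "closed {0<..t}"
    then have "closure {0<..t} = {0<..t}" by (rule closure_closed)
    then show False using assms by auto
  qed
  moreover have "closedin (top_of_set {0<..<1}) {0<..t}"
    unfolding closedin_closed using assms by (intro exI[of _ "{0..t}"]) auto
  moreover have "{0<..t} \<subseteq> {0<..<1}" using assms by auto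
  ultimately show "\<not> bounded (f l ` {0<..t})" using * compact_imp_closed by blast
  have "\<not> closed {t..<1}"
  proof
    assume "closed {t..<1}"
    then have "closure {t..<1} = {t..<1}" by (rule closure_closed)
    then show False using assms by auto
  qed
  moreover have "closedin (top_of_set {0<..<1}) {t..<1}"
    unfolding closedin_closed using assms by (intro exI[of _ "{t..1}"]) auto
  moreover have "{t..<1} \<subseteq> {0<..<1}" using assms by auto
  ultimately show "\<not> bounded (f l ` {t..<1})" using * compact_imp_closed by blast
qed

text \<open>From a point of \<open>l\<close> inside \<open>J\<close>, at least one of the two rays
  misses the interval \<open>C\<close>. It would stay inside \<open>J\<close> forever, although rays
  are unbounded. An empty \<open>C\<close> covers the lines that miss \<open>J\<close>.\<close>

lemma line_avoids_inside:
  assumes "l \<in> L" "J \<inter> l = f l ` C" "C \<subseteq> {0<..<1}" "is_interval C" "bounded (inside J)"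
  shows "l \<inter> inside J = {}"
proof (rule ccontr)
  assume "l \<inter> inside J \<noteq> {}"
  then obtain x where x: "x \<in> l" "x \<in> inside J" by blast
  define t where "t = f' l x"
  have t: "0 < t" "t < 1" "f l t = x" using assms(1) x f'_in by (auto simp: t_def)
  have "t \<notin> C"
  proof
    assume "t \<in> C"
    then have "x \<in> J" using t assms(2) by blast
    then show False using x inside_no_overlap by blast
  qed
  have bdd: "bounded (f l ` I)" if I: "I \<subseteq> {0<..<1}" "connected I" "t \<in> I" "I \<inter> C = {}" for I
  proof -
    have "connected (f l ` I)"
      using cont_f[OF assms(1)] I by (intro connected_continuous_image) (auto intro: continuous_on_subset)
    moreover have "f l ` I \<subseteq> - J"
    proof -
      have False if "s \<in> I" "f l s \<in> J" for s
      proof -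
        have "0 < s" "s < 1" using that I by auto
        then have "f l s \<in> f l ` C" using that f_in assms(1,2) by blast
        then obtain c where "c \<in> C" "f l s = f l c" by blast
        then have "s = c" using f'_f[OF assms(1)] assms(3) \<open>0 < s\<close> \<open>s < 1\<close>
          by (metis greaterThanLessThan_iff subsetD)
        then show False using \<open>c \<in> C\<close> that I by blast
      qed
      then show ?thesis by auto
    qed
    ultimately have "connected_component (- J) x y" if "y \<in> f l ` I" for y
      unfolding connected_component_def using that I(3) t(3) by blast
    then have "f l ` I \<subseteq> inside J" using inside_same_component[of J x] x(2) by blast
    then show ?thesis using assms(5) bounded_subset by blast
  qed
  have "{0<..t} \<inter> C = {} \<or> {t..<1} \<inter> C = {}"
  proof (rule ccontr)
    assume "\<not> ?thesis"
    then obtain a b where "a \<in> C" "a \<le> t" "b \<in> C" "t \<le> b" by auto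
    then have "t \<in> C" using assms(4) unfolding is_interval_1 by blast
    with \<open>t \<notin> C\<close> show False ..
  qed
  moreover have "{0<..t} \<subseteq> {0<..<1}" "{t..<1} \<subseteq> {0<..<1}" "t \<in> {0<..t}" "t \<in> {t..<1}"
    using t by auto
  ultimately show False
    using bdd[of "{0<..t}"] bdd[of "{t..<1}"] unbounded_rays[OF assms(1) t(1,2)] by (metis connected_Ioc connected_Ico)
qed

definition seg_path :: "complex set \<Rightarrow> complex \<Rightarrow> complex \<Rightarrow> real \<Rightarrow> complex" where
  "seg_path l a b = f l \<circ> linepath (f' l a) (f' l b)"

lemma seg_path:
  assumes "l \<in> L" "a \<in> l" "b \<in> l" "a \<noteq> b"
  shows "arc (seg_path l a b)" "pathstart (seg_path l a b) = a" "pathfinish (seg_path l a b) = b"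
    "path_image (seg_path l a b) = seg l a b \<union> {a, b}"
proof -
  have sub: "closed_segment (f' l a) (f' l b) \<subseteq> {0<..<1}" using assms by (intro closed_segment_f'_sub)
  show "arc (seg_path l a b)" unfolding seg_path_def
    arc_def
  proof
    have arc: "arc (linepath (f' l a) (f' l b))" using assms by (intro arc_linepath) (simp add: f'_eq_iff)
    show "path (f l \<circ> linepath (f' l a) (f' l b))"
      using sub by (intro path_continuous_image continuous_on_subset[OF cont_f[OF assms(1)]]) auto
    have "inj_on (f l) {0<..<1}"
      by (rule inj_on_inverseI[where g = "f' l"]) (use assms(1) in simp)
    then have "inj_on (f l) (linepath (f' l a) (f' l b) ` {0..1})"
      by (rule inj_on_subset) (use sub in \<open>simp add: linepath_image_01\<close>)
    with arc show "inj_on (f l \<circ> linepath (f' l a) (f' l b)) {0..1}"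
      unfolding arc_def by (intro comp_inj_on) auto
  qed
  show "pathstart (seg_path l a b) = a" "pathfinish (seg_path l a b) = b"
    using assms by (auto simp: seg_path_def pathstart_compose pathfinish_compose)
  show "path_image (seg_path l a b) = seg l a b \<union> {a, b}"
    using assms by (simp add: seg_path_def path_image_compose f_closed_segment)
qed

text \<open>For maximality: a larger connected set in the punctured line has an interval of
  parameters, and this cannot pass the two ends of the segment, which lie on \<open>i\<close> and
  \<open>j\<close>.\<close>

lemma seg_component:
  assumes "l \<in> L" "i \<in> L" "j \<in> L" "l \<noteq> i" "l \<noteq> j" "i \<noteq> j"
    and free: "uncrossed l (crossing l i) (crossing l j)"
  shows "seg l (crossing l i) (crossing l j) \<in> components (l - \<Union>(L - {l}))"
    and "(seg l (crossing l i) (crossing l j) \<union> {crossing l i, crossing l j}) - (i \<union> j) = seg l (crossing l i) (crossing l j)"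
proof -
  let ?a = "crossing l i" and ?b = "crossing l j"
  have ab: "?a \<in> l" "?b \<in> l" "?a \<in> i" "?b \<in> j" using crossing_in assms by auto
  have "?a \<noteq> ?b" using crossing_inj[of l i j] assms by auto
  then have "f' l ?a \<noteq> f' l ?b" using f'_eq_iff assms(1) ab by metis
  have sub: "seg l ?a ?b \<subseteq> l - \<Union>(L - {l})"
  proof
    fix x assume x: "x \<in> seg l ?a ?b"
    then have "x \<in> l" using mem_seg assms(1) ab by blast
    moreover have "x \<notin> k" if "k \<in> L - {l}" for k
      using free x that crossing_unique[of l k x] assms(1) \<open>x \<in> l\<close> unfolding uncrossed_def by blast
    ultimately show "x \<in> l - \<Union>(L - {l})" by blast
  qed
  have open_sub: "open_segment (f' l ?a) (f' l ?b) \<subseteq> {0<..<1}"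
    using closed_segment_f'_sub[OF assms(1) ab(1,2)] segment_open_subset_closed by blast
  show "seg l ?a ?b \<in> components (l - \<Union>(L - {l}))"
    unfolding in_components_maximal
  proof (intro conjI allI impI)
    show "seg l ?a ?b \<noteq> {}" using \<open>f' l ?a \<noteq> f' l ?b\<close> by (simp add: seg_def)
    show "seg l ?a ?b \<subseteq> l - \<Union>(L - {l})" by (rule sub)
    show "connected (seg l ?a ?b)" unfolding seg_def
      using open_sub
      by (intro connected_continuous_image continuous_on_subset[OF cont_f[OF assms(1)]] convex_connected)
        auto
    fix d assume d: "d \<noteq> {} \<and> seg l ?a ?b \<subseteq> d \<and> d \<subseteq> l - \<Union>(L - {l}) \<and> connected d"
    then have dl: "d \<subseteq> l" by blast
    have "connected (f' l ` d)"
      using d continuous_on_subset[OF cont_f'[OF assms(1)] dl] connected_continuous_image by blast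
    then have int: "is_interval (f' l ` d)" using is_interval_connected_1 by blast
    have notab: "f' l ?a \<notin> f' l ` d" "f' l ?b \<notin> f' l ` d"
    proof -
      have "?a \<notin> d" "?b \<notin> d" using d ab assms by auto
      then show "f' l ?a \<notin> f' l ` d" "f' l ?b \<notin> f' l ` d"
        using f'_eq_iff[OF assms(1)] ab(1,2) dl by blast+
    qed
    obtain m where m: "m \<in> open_segment (f' l ?a) (f' l ?b)"
      using \<open>f' l ?a \<noteq> f' l ?b\<close> open_segment_eq_empty[of "f' l ?a" "f' l ?b"] by blast
    then have "m \<in> f' l ` d"
    proof -
      have "0 < m" "m < 1" using m open_sub by auto
      moreover have "f l m \<in> d" using m d by (auto simp: seg_def)
      ultimately show ?thesis using f'_f[OF assms(1), of m] by (metis imageI)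
    qed
    have "d \<subseteq> seg l ?a ?b"
    proof
      fix x assume x: "x \<in> d"
      then have x': "f' l x \<in> f' l ` d" by blast
      have "f' l x \<in> open_segment (f' l ?a) (f' l ?b)"
        using int x' \<open>m \<in> f' l ` d\<close> m notab unfolding is_interval_1 open_segment_real_iff
        by (smt (verit))
      then show "x \<in> seg l ?a ?b" using mem_seg[OF assms(1) ab(1,2)] x dl by blast
    qed
    then show "d = seg l ?a ?b" using d by blast
  qed
  show "(seg l ?a ?b \<union> {?a, ?b}) - (i \<union> j) = seg l ?a ?b"
    using sub ab assms by blast
qed

text \<open>Each of the three lines meets the closed curve \<open>J\<close> in one closed segment
  and every other line misses it, so no line enters the interior.\<close>

lemma uncrossed_triangle_cell:
  assumes mem: "l \<in> L" "i \<in> L" "j \<in> L" and dist: "l \<noteq> i" "l \<noteq> j" "i \<noteq> j"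
    and free: "uncrossed l (crossing l i) (crossing l j)" "uncrossed i (crossing i l) (crossing i j)"
      "uncrossed j (crossing j l) (crossing j i)"
  shows "\<exists>T\<in>triangles L. seg l (crossing l i) (crossing l j) \<in> edges_of L T"
proof -
  let ?A = "crossing l i" and ?B = "crossing l j" and ?V = "crossing i j"
  let ?sl = "seg l ?A ?B" and ?si = "seg i ?V ?A" and ?sj = "seg j ?B ?V"
  have comm: "crossing i l = ?A" "crossing j l = ?B" "crossing j i = ?V" by (simp_all add: crossing_commute)
  have A: "?A \<in> l" "?A \<in> i" "?A \<notin> j" and B: "?B \<in> l" "?B \<in> j" "?B \<notin> i" and V: "?V \<in> i" "?V \<in> j" "?V \<notin> l"
    using crossing_in crossing_notin mem dist by auto
  have ne: "?A \<noteq> ?B" "?B \<noteq> ?V" "?V \<noteq> ?A" using A B V by metis+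
  have comp: "?sl \<in> components (l - \<Union>(L - {l}))" "?si \<in> components (i - \<Union>(L - {i}))"
      "?sj \<in> components (j - \<Union>(L - {j}))"
    using seg_component(1)[OF mem(1,2,3)] seg_component(1)[OF mem(2,1,3)] seg_component(1)[OF mem(3,1,2)]
      dist free by (auto simp: comm seg_commute)
  have sub: "?sl \<subseteq> l - \<Union>(L - {l})" "?si \<subseteq> i - \<Union>(L - {i})" "?sj \<subseteq> j - \<Union>(L - {j})"
    using comp in_components_subset by blast+
  have S: "?sl \<subseteq> l" "?si \<subseteq> i" "?sj \<subseteq> j" using sub by blast+
  have D: "?sl \<inter> i = {}" "?sl \<inter> j = {}" "?si \<inter> l = {}" "?si \<inter> j = {}" "?sj \<inter> l = {}" "?sj \<inter> i = {}"
    using sub mem dist by blast+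
  have nin: "?A \<notin> ?sj" "?B \<notin> ?si" "?V \<notin> ?sl" "?sj \<inter> ?si = {}" "?sl \<inter> ?sj = {}" "?sl \<inter> ?si = {}"
    using S D A B V by blast+
  note pl = seg_path[OF mem(1) A(1) B(1) ne(1)] and pj = seg_path[OF mem(3) B(2) V(2) ne(2)]
    and pi = seg_path[OF mem(2) V(1) A(2) ne(3)]
  define J where "J = ?sl \<union> ?sj \<union> ?si \<union> {?A, ?B, ?V}"
  define c where "c = seg_path l ?A ?B +++ (seg_path j ?B ?V +++ seg_path i ?V ?A)"
  have img: "path_image (seg_path j ?B ?V +++ seg_path i ?V ?A) = ?sj \<union> ?si \<union> {?A, ?B, ?V}"
    using pj pi by (subst path_image_join) auto
  have "arc (seg_path j ?B ?V +++ seg_path i ?V ?A)"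
  proof (rule arc_join)
    show "path_image (seg_path j ?B ?V) \<inter> path_image (seg_path i ?V ?A) \<subseteq> {pathstart (seg_path i ?V ?A)}"
      using nin ne unfolding pj pi by auto
  qed (use pj pi in auto)
  then have "simple_path c" unfolding c_def
  proof (rule simple_path_join_loop[OF pl(1)])
    show "path_image (seg_path l ?A ?B) \<inter> path_image (seg_path j ?B ?V +++ seg_path i ?V ?A)
      \<subseteq> {pathstart (seg_path l ?A ?B), pathstart (seg_path j ?B ?V +++ seg_path i ?V ?A)}"
      using nin unfolding img pl pj pathstart_join by auto
  qed (use pl pj pi in auto)
  moreover have "pathfinish c = pathstart c" using pl pi by (simp add: c_def)
  moreover have "path_image c = J"
    unfolding c_def J_def using pl pj img by (subst path_image_join) auto
  ultimately have T: "inside J \<noteq> {}" "connected (inside J)" "bounded (inside J)" "frontier (inside J) = J"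
    using Jordan_inside_outside[of c] by auto
  have Jl: "J \<inter> l = ?sl \<union> {?A, ?B}" using S(1) D(3,5) A B V unfolding J_def by blast
  have Ji: "J \<inter> i = ?si \<union> {?V, ?A}" using S(2) D(1,6) A B V unfolding J_def by blast
  have Jj: "J \<inter> j = ?sj \<union> {?B, ?V}" using S(3) D(2,4) A B V unfolding J_def by blast
  have Jk: "J \<inter> k = {}" if "k \<in> L - {l, i, j}" for k
  proof -
    have "?A \<notin> k" "?B \<notin> k" "?V \<notin> k" using crossing_notin that mem dist by auto
    then show ?thesis using sub that unfolding J_def by blast
  qed
  have JL: "J \<subseteq> \<Union>L" using sub A B V mem unfolding J_def by blast
  have avoid: "k \<inter> inside J = {}" if kL: "k \<in> L" for k
  proof -
    have "\<exists>C. J \<inter> k = f k ` C \<and> C \<subseteq> {0<..<1} \<and> is_interval C"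
    proof -
      have seg: "\<exists>C. J \<inter> k = f k ` C \<and> C \<subseteq> {0<..<1} \<and> is_interval C"
        if "J \<inter> k = seg k a b \<union> {a, b}" "a \<in> k" "b \<in> k" for a b
        using f_closed_segment[OF \<open>k \<in> L\<close> that(2,3)] closed_segment_f'_sub[OF \<open>k \<in> L\<close> that(2,3)] that(1)
        by (intro exI[of _ "closed_segment (f' k a) (f' k b)"]) (simp add: is_interval_convex_1)
      consider "k = l" | "k = i" | "k = j" | "k \<in> L - {l, i, j}" using kL by blast
      then show ?thesis
      proof cases
        case 4
        then show ?thesis using Jk[of k] by (intro exI[of _ "{}"]) auto
      qed (use seg Jl Ji Jj A B V in blast)+
    qed
    then show ?thesis using line_avoids_inside[OF that] T(3) by blast
  qed
  have "inside J \<in> components (- \<Union>L)"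
    unfolding in_components_maximal
  proof (intro conjI allI impI T(1,2))
    show "inside J \<subseteq> - \<Union>L" using avoid by blast
    fix d assume d: "d \<noteq> {} \<and> inside J \<subseteq> d \<and> d \<subseteq> - \<Union>L \<and> connected d"
    obtain x where x: "x \<in> inside J" using T(1) by blast
    \<comment> \<open>Since \<open>J\<close> is covered by the lines, a connected set that avoids
      all lines cannot leave the interior.\<close>
    have "y \<in> inside J" if "y \<in> d" for y
    proof -
      have "connected_component (- J) x y"
        unfolding connected_component_def using d JL x that by (intro exI[of _ d]) blast
      then show ?thesis using inside_same_component x by blast
    qed
    then show "d = inside J" using d by blast
  qed
  then have poly: "inside J \<in> polygons L" using T(3) by (simp add: polygons_def)
  have edges: "edges_of L (inside J) = {?sl, ?sj, ?si}"
  proof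
    show "{?sl, ?sj, ?si} \<subseteq> edges_of L (inside J)"
      using comp mem T(4) by (auto simp: edges_of_def edges_def J_def)
    show "edges_of L (inside J) \<subseteq> {?sl, ?sj, ?si}"
    proof
      fix e assume "e \<in> edges_of L (inside J)"
      then obtain k where k: "k \<in> L" "e \<in> components (k - \<Union>(L - {k}))" "e \<subseteq> J"
        using T(4) by (auto simp: edges_of_def edges_def)
      have e: "e \<noteq> {}" "e \<subseteq> k - \<Union>(L - {k})"
        using k(2) in_components_nonempty in_components_subset by blast+
      \<comment> \<open>Distinct components are disjoint, so an edge contained in one of the three
        sides is that side.\<close>
      have eq: "e = s" if "s \<in> components (k - \<Union>(L - {k}))" "e \<subseteq> s" for s
        using components_nonoverlap[OF k(2) that(1)] that(2) e(1) by blast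
      have "e \<subseteq> J \<inter> k" using e k(3) by blast
      consider "k = l" | "k = i" | "k = j" | "k \<in> L - {l, i, j}" using k(1) by blast
      then show "e \<in> {?sl, ?sj, ?si}"
      proof cases
        case 1
        then have "e \<subseteq> ?sl" using e(2) \<open>e \<subseteq> J \<inter> k\<close> Jl A B mem dist by blast
        then show ?thesis using eq comp(1) 1 by blast
      next
        case 2
        then have "e \<subseteq> ?si" using e(2) \<open>e \<subseteq> J \<inter> k\<close> Ji A V mem dist by blast
        then show ?thesis using eq comp(2) 2 by blast
      next
        case 3
        then have "e \<subseteq> ?sj" using e(2) \<open>e \<subseteq> J \<inter> k\<close> Jj B V mem dist by blast
        then show ?thesis using eq comp(3) 3 by blast
      next
        case 4
        then show ?thesis using Jk e(1) \<open>e \<subseteq> J \<inter> k\<close> by blast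
      qed
    qed
  qed
  have "?sl \<noteq> {}" "?si \<noteq> {}" "?sj \<noteq> {}" using comp in_components_nonempty by blast+
  then have "?sl \<noteq> ?sj" "?sl \<noteq> ?si" "?sj \<noteq> ?si" using sub mem dist by blast+
  then have "card (edges_of L (inside J)) = 3" unfolding edges by simp
  then have "inside J \<in> triangles L" using poly by (simp add: triangles_def)
  then show ?thesis using edges by blast
qed

end

theorem proposition9:
  fixes L :: "complex set set"
  assumes "Euclidean_arrangement L"
    and "simple_arrangement L"
    and "card L \<ge> 3"
  shows "\<forall>l\<in>L. \<exists>T\<in>triangles L. \<exists>e\<in>edges_of L T. e \<subseteq> l"
proof
  fix l assume l: "l \<in> L"
  obtain f f' where hom: "\<forall>l\<in>L. homeomorphism {0<..<1::real} l (f l) (f' l)"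
    and sep: "\<forall>l\<in>L. \<forall>m\<in>L. \<forall>t u v. l \<noteq> m \<and> 0 < t \<and> t < u \<and> u < v \<and> v < 1 \<and> f m u \<in> l \<longrightarrow>
       \<not> connected_component (- l) (f m t) (f m v)"
    using Euclidean_arrangement_structure(4)[OF assms(1)] by (elim exE conjE) (rule that)
  interpret parametrised_arrangement L f f'
  proof
    show "\<not> connected_component (- l) (f m t) (f m v)"
      if "l \<in> L" "m \<in> L" "l \<noteq> m" "0 < t" "t < u" "u < v" "v < 1" "f m u \<in> l" for l m t u v
      using sep that by blast
  qed (use Euclidean_arrangement_structure(1-3)[OF assms(1)] assms(2) hom in auto)
  obtain i j where ij: "i \<in> L" "j \<in> L" "l \<noteq> i" "l \<noteq> j" "i \<noteq> j"
    "uncrossed l (crossing l i) (crossing l j)" "uncrossed i (crossing i l) (crossing i j)"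
    "uncrossed j (crossing j l) (crossing j i)"
    using exists_uncrossed_triangle[OF l assms(3)] .
  then obtain T where "T \<in> triangles L" "seg l (crossing l i) (crossing l j) \<in> edges_of L T"
    using uncrossed_triangle_cell[OF l] by blast
  moreover have "seg l (crossing l i) (crossing l j) \<subseteq> l"
    using mem_seg[OF l] crossing_in(1)[OF l] ij by blast
  ultimately show "\<exists>T\<in>triangles L. \<exists>e\<in>edges_of L T. e \<subseteq> l" by blast
qed

end
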